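(* For $k=0,1,2,\dots$ consider $\dot x(t)=A(u^k(t))x(t)+Cu^k(t)+d$, where $u^k$ is a $\tau_k$-periodic control with values in $\Omega$, $\tau_k\to\tau_0>0$, $u^k\to u^0$ in $L^1([0,\tau_0+1],\mathbb R^m)$, and $\|u^k\|_\infty\le c$ for some $c>0$. Assume (i) $1\in\mathrm{spec}(\Phi_{u^0}(\tau_0,0))$ and $1\notin\mathrm{spec}(\Phi_{u^k}(\tau_k,0))$ for $k\ge1$, and (ii) $\int_0^{\tau_0}\Phi_{u^0}(\tau_0,s)(Cu^0(s)+d)ds\notin\mathrm{Im}(I-\Phi_{u^0}(\tau_0,0))$. Then for each $k\ge1$ there is a unique $\tau_k$-periodic solution for $u^k$, and its initial value $x^k$ satisfies $\|x^k\|\to\infty$ and $d\big(x^k/\|x^k\|,\ker(I-\Phi_{u^0}(\tau_0,0))\big)\to0$ as $k\to\infty$, where $\ker(I-\Phi_{u^0}(\tau_0,0))=\mathbf E(\Phi_{u^0}(\tau_0,0);1)$.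
   Context: $A,B_1,\dots,B_m\in\mathbb R^{n\times n}$, $c_i,d\in\mathbb R^n$, $A(u)=A+\sum_iu_iB_i$, $C=(c_1,\dots,c_m)$, $\Omega\subset\mathbb R^m$ bounded. $\Phi_u(t,s)$ is the principal fundamental solution of $\dot x=A(u(t))x$. $\mathbf E(M;1)$ denotes the real eigenspace of $M$ for eigenvalue $1$; $d(x,Y)$ is the distance from $x$ to the set $Y$. *)

theory Defs
  imports "HOL-Analysis.Analysis"
begin

text \<open>A(u) = A + sum_i u_i B_i\<close>
definition Amat :: "real^'n^'n \<Rightarrow> ('m::finite \<Rightarrow> real^'n^'n) \<Rightarrow> real^'m \<Rightarrow> real^'n^'n" where
  "Amat A B w = A + (\<Sum>i\<in>UNIV. (w $ i) *\<^sub>R B i)"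

text \<open>Principal fundamental solution Phi_u(t,s) (for t \<ge> s) of the linear system
  x' = A(u(t)) x, in the Caratheodory (integral-equation) sense.\<close>
definition fundsol :: "real^'n^'n \<Rightarrow> ('m::finite \<Rightarrow> real^'n^'n) \<Rightarrow> (real \<Rightarrow> real^'m)
    \<Rightarrow> real \<Rightarrow> real \<Rightarrow> real^'n^'n" where
  "fundsol A B u t s = (THE M. \<exists>\<Phi>. \<Phi> s = mat 1 \<and>
      (\<forall>a b. s \<le> a \<longrightarrow> a \<le> b \<longrightarrow>
         ((\<lambda>r. Amat A B (u r) ** \<Phi> r) has_integral (\<Phi> b - \<Phi> a)) {a..b}) \<and>
      \<Phi> t = M)"

text \<open>Caratheodory solution on the whole real line of x' = A(u)x + Cu + d.\<close>
definition is_solution :: "real^'n^'n \<Rightarrow> ('m::finite \<Rightarrow> real^'n^'n) \<Rightarrow> real^'m^'n \<Rightarrow> real^'n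
    \<Rightarrow> (real \<Rightarrow> real^'m) \<Rightarrow> (real \<Rightarrow> real^'n) \<Rightarrow> bool" where
  "is_solution A B C d u x \<longleftrightarrow>
     (\<forall>a b. a \<le> b \<longrightarrow>
        ((\<lambda>r. Amat A B (u r) *v x r + C *v u r + d) has_integral (x b - x a)) {a..b})"

definition is_periodic_solution :: "real^'n^'n \<Rightarrow> ('m::finite \<Rightarrow> real^'n^'n) \<Rightarrow> real^'m^'n \<Rightarrow> real^'n
    \<Rightarrow> (real \<Rightarrow> real^'m) \<Rightarrow> real \<Rightarrow> (real \<Rightarrow> real^'n) \<Rightarrow> bool" where
  "is_periodic_solution A B C d u \<tau> x \<longleftrightarrow>
     is_solution A B C d u x \<and> (\<forall>t. x (t + \<tau>) = x t)"

text \<open>1 belongs to the spectrum of a real matrix M (equivalently: M has the real eigenvalue 1).\<close>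
definition one_in_spec :: "real^'n^'n \<Rightarrow> bool" where
  "one_in_spec M \<longleftrightarrow> (\<exists>v. v \<noteq> 0 \<and> M *v v = v)"

text \<open>Real eigenspace E(M; lambda).\<close>
definition eigenspace_real :: "real^'n^'n \<Rightarrow> real \<Rightarrow> (real^'n) set" where
  "eigenspace_real M lam = {v. M *v v = lam *\<^sub>R v}"

end

theory Submission
  imports Defs
begin

text \<open>Write \<open>\<Phi>\<^sub>k = \<Phi>\<^bsub>u\<^sup>k\<^esub>(\<tau>\<^sub>k, 0)\<close> and let \<open>p\<^sub>k\<close> be the solution for the control \<open>u\<^sup>k\<close> with
  \<open>p\<^sub>k(0) = 0\<close>. Every solution is \<open>x(t) = \<Phi>\<^bsub>u\<^sup>k\<^esub>(t, 0) x(0) + p\<^sub>k(t)\<close>, so the \<open>\<tau>\<^sub>k\<close>-periodic ones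
  are those with \<open>(I - \<Phi>\<^sub>k) x(0) = p\<^sub>k(\<tau>\<^sub>k)\<close>, a uniquely solvable system for \<open>k \<ge> 1\<close>.
  By Gronwall's inequality these data depend continuously on the control in \<open>L\<^sup>1\<close>, so
  \<open>\<Phi>\<^sub>k \<rightarrow> \<Phi>\<^sub>0\<close> and \<open>p\<^sub>k(\<tau>\<^sub>k) \<rightarrow> p\<^sub>0(\<tau>\<^sub>0)\<close>; by the variation of constants formula \<open>p\<^sub>0(\<tau>\<^sub>0)\<close> is the
  integral in the nonresonance hypothesis, hence not in the range of \<open>I - \<Phi>\<^sub>0\<close>. Bounded initial
  values \<open>x\<^sup>k\<close> would give in the limit a solution of \<open>(I - \<Phi>\<^sub>0) x = p\<^sub>0(\<tau>\<^sub>0)\<close>; hence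
  \<open>\<parallel>x\<^sup>k\<parallel> \<rightarrow> \<infinity>\<close>, and dividing the equations by \<open>\<parallel>x\<^sup>k\<parallel>\<close> shows that \<open>x\<^sup>k/\<parallel>x\<^sup>k\<parallel>\<close> approaches the
  kernel of \<open>I - \<Phi>\<^sub>0\<close>.\<close>

section \<open>Matrix norms\<close>

lemma norm_cart_power2: "norm (x :: 'a::real_normed_vector^'n) ^ 2 = (\<Sum>i\<in>UNIV. norm (x $ i) ^ 2)"
  by (simp add: norm_vec_def L2_set_def sum_nonneg)

lemma norm_matrix_vector_mult_le: "norm ((A :: real^'n^'m) *v x) \<le> norm A * norm x"
proof -
  have row: "\<bar>(A *v x) $ i\<bar> \<le> norm (A $ i) * norm x" for i
    using Cauchy_Schwarz_ineq2[of "A $ i" x]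
    by (simp add: matrix_vector_mult_def inner_vec_def mult.commute)
  have "norm (A *v x) ^ 2 = (\<Sum>i\<in>UNIV. \<bar>(A *v x) $ i\<bar> ^ 2)"
    by (simp add: norm_cart_power2)
  also have "\<dots> \<le> (\<Sum>i\<in>UNIV. (norm (A $ i) * norm x) ^ 2)"
    by (intro sum_mono power_mono row) simp
  also have "\<dots> = (norm A * norm x) ^ 2"
    by (simp add: norm_cart_power2[of A] power_mult_distrib sum_distrib_right)
  finally show ?thesis
    by (rule power2_le_imp_le) simp
qed

lemma norm_transpose: "norm (transpose (A :: real^'n^'m)) = norm A"
proof -
  have "norm (transpose A) ^ 2 = norm A ^ 2"
    by (simp add: transpose_def norm_cart_power2) (rule sum.swap)
  then show ?thesis by (simp add: power2_eq_iff_nonneg)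
qed

lemma norm_matrix_mult_le: "norm ((A :: real^'n^'m) ** B) \<le> norm A * norm (B :: real^'k^'n)"
proof -
  have "(A ** B) $ i = transpose B *v A $ i" for i
    by (simp add: vec_eq_iff matrix_matrix_mult_def matrix_vector_mult_def transpose_def mult.commute)
  then have row: "norm ((A ** B) $ i) \<le> norm (A $ i) * norm B" for i
    using norm_matrix_vector_mult_le[of "transpose B" "A $ i"] by (simp add: norm_transpose mult.commute)
  have "norm (A ** B) ^ 2 = (\<Sum>i\<in>UNIV. norm ((A ** B) $ i) ^ 2)"
    by (simp add: norm_cart_power2)
  also have "\<dots> \<le> (\<Sum>i\<in>UNIV. (norm (A $ i) * norm B) ^ 2)"
    by (intro sum_mono power_mono row) simp
  also have "\<dots> = (norm A * norm B) ^ 2"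
    by (simp add: norm_cart_power2[of A] power_mult_distrib sum_distrib_right)
  finally show ?thesis
    by (rule power2_le_imp_le) simp
qed

lemma bounded_bilinear_matrix_vector_mult:
  "bounded_bilinear (\<lambda>(A::real^'n^'m) (x::real^'n). A *v x)"
  unfolding bilinear_conv_bounded_bilinear[symmetric]
  by (auto simp: bilinear_def linear_iff vec_eq_iff matrix_vector_mult_def sum.distrib
      sum_distrib_left algebra_simps)

lemma bounded_bilinear_matrix_mult:
  "bounded_bilinear (\<lambda>(A::real^'n^'m) (B::real^'k^'n). A ** B)"
  unfolding bilinear_conv_bounded_bilinear[symmetric]
  by (auto simp: bilinear_def linear_iff vec_eq_iff matrix_matrix_mult_def sum.distrib
      sum_distrib_left algebra_simps)

section \<open>Two lemmas of real analysis\<close>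

lemma gronwall:
  fixes \<phi> :: "real \<Rightarrow> real"
  assumes cont: "continuous_on {s..T} \<phi>"
    and ineq: "\<And>r. r \<in> {s..T} \<Longrightarrow> \<phi> r \<le> \<epsilon> + K * integral {s..r} \<phi>"
    and K: "0 \<le> K" and t: "t \<in> {s..T}"
  shows "\<phi> t \<le> \<epsilon> * exp (K * (t - s))"
proof -
  define \<Psi> where "\<Psi> r = \<epsilon> + K * integral {s..r} \<phi>" for r
  have \<Psi>_deriv: "(\<Psi> has_real_derivative K * \<phi> r) (at r)" if "s < r" "r < T" for r
  proof -
    have "((\<lambda>x. integral {s..x} \<phi>) has_real_derivative \<phi> r) (at r within {s..T})"
      using that by (intro integral_has_real_derivative cont) auto
    then have "((\<lambda>x. integral {s..x} \<phi>) has_real_derivative \<phi> r) (at r)"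
      using that by (simp add: at_within_Icc_at)
    then show ?thesis unfolding \<Psi>_def[abs_def] by (auto intro!: derivative_eq_intros)
  qed
  have \<Psi>_cont: "continuous_on {s..T} \<Psi>"
    unfolding \<Psi>_def[abs_def] by (intro continuous_intros indefinite_integral_continuous_1 integrable_continuous_interval cont)
  define E where "E r = \<Psi> r * exp (- K * (r - s))" for r
  \<comment> \<open>the hypothesis \<open>\<phi> \<le> \<Psi>\<close> makes the derivative of \<open>E\<close> nonpositive\<close>
  have "E t \<le> E s"
  proof (rule DERIV_nonpos_imp_decreasing_open[of s t E])
    fix r assume r: "s < r" "r < t"
    then have "r < T" using t by auto
    show "\<exists>y. (E has_real_derivative y) (at r) \<and> y \<le> 0"
    proof (intro exI conjI)
      show "(E has_real_derivative
              K * (\<phi> r - \<Psi> r) * exp (- K * (r - s))) (at r)"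
        using \<Psi>_deriv[OF r(1) \<open>r < T\<close>] unfolding E_def[abs_def]
        by (auto intro!: derivative_eq_intros simp: algebra_simps)
      show "K * (\<phi> r - \<Psi> r) * exp (- K * (r - s)) \<le> 0"
        using ineq[of r] r \<open>r < T\<close> K unfolding \<Psi>_def
        by (intro mult_nonpos_nonneg mult_nonneg_nonpos) auto
    qed
  next
    show "continuous_on {s..t} E"
      using t unfolding E_def[abs_def] by (intro continuous_intros continuous_on_subset[OF \<Psi>_cont]) auto
  qed (use t in auto)
  moreover have "\<Psi> t = E t * exp (K * (t - s))" "E s = \<epsilon>"
    by (simp_all add: E_def \<Psi>_def mult.assoc flip: exp_add)
  ultimately have "\<Psi> t \<le> \<epsilon> * exp (K * (t - s))"
    by (simp add: mult_right_mono)
  then show ?thesis using ineq[OF t] unfolding \<Psi>_def by linarith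
qed

lemma eq_if_quadratic_increments:
  fixes h :: "real \<Rightarrow> 'a::real_normed_vector"
  assumes ab: "a \<le> b"
    and inc: "\<And>t t'. a \<le> t \<Longrightarrow> t \<le> t' \<Longrightarrow> t' \<le> b \<Longrightarrow> norm (h t' - h t) \<le> K * (t' - t)\<^sup>2"
  shows "h b = h a"
proof -
  have "norm (h b - h a) \<le> K * (b - a)\<^sup>2 / real N" if N: "N \<ge> 1" for N :: nat
  proof -
    define \<delta> where "\<delta> = (b - a) / real N"
    define t where "t i = a + real i * \<delta>" for i
    have \<delta>: "0 \<le> \<delta>" "real N * \<delta> = b - a" using ab N by (simp_all add: \<delta>_def)
    have "h b - h a = (\<Sum>i<N. h (t (Suc i)) - h (t i))"
      using \<delta>(2) by (subst sum_lessThan_telescope) (simp add: t_def)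
    also have "norm \<dots> \<le> (\<Sum>i<N. norm (h (t (Suc i)) - h (t i)))" by (rule norm_sum)
    also have "\<dots> \<le> (\<Sum>i<N. K * \<delta>\<^sup>2)"
    proof (rule sum_mono)
      fix i assume "i \<in> {..<N}"
      then have "real (Suc i) * \<delta> \<le> real N * \<delta>" using \<delta>(1) by (intro mult_right_mono) auto
      then have "a \<le> t i" "t i \<le> t (Suc i)" "t (Suc i) \<le> b" "t (Suc i) - t i = \<delta>"
        using \<delta> by (auto simp: t_def algebra_simps)
      then show "norm (h (t (Suc i)) - h (t i)) \<le> K * \<delta>\<^sup>2"
        using inc by metis
    qed
    also have "\<dots> = K * (b - a)\<^sup>2 / real N" using N by (simp add: \<delta>_def power2_eq_square)
    finally show ?thesis .
  qed
  moreover have "(\<lambda>N. K * (b - a)\<^sup>2 / real N) \<longlonglongrightarrow> 0" by (rule lim_const_over_n)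
  ultimately have "norm (h b - h a) \<le> 0"
    by (intro LIMSEQ_le_const[of "\<lambda>N. K * (b - a)\<^sup>2 / real N"]) (auto intro!: exI[of _ 1])
  then show ?thesis by simp
qed

section \<open>Linear equations in integral form\<close>

text \<open>\<open>X\<close> solves \<open>X' = p (M r) X + g r\<close> on \<open>[s, \<infinity>)\<close> in integral form; \<open>p\<close> will be the
  matrix-vector or the matrix-matrix product.\<close>
definition solves_from ::
    "('m::euclidean_space \<Rightarrow> 'a::euclidean_space \<Rightarrow> 'a) \<Rightarrow> (real \<Rightarrow> 'm) \<Rightarrow> (real \<Rightarrow> 'a)
      \<Rightarrow> real \<Rightarrow> (real \<Rightarrow> 'a) \<Rightarrow> bool" where
  "solves_from p M g s X \<longleftrightarrow>
     (\<forall>a b. s \<le> a \<longrightarrow> a \<le> b \<longrightarrow> ((\<lambda>r. p (M r) (X r) + g r) has_integral (X b - X a)) {a..b})"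

lemma solves_from_mono: "solves_from p M g s X \<Longrightarrow> s \<le> s' \<Longrightarrow> solves_from p M g s' X"
  unfolding solves_from_def by auto

lemma integrable_bounded_borel:
  fixes f :: "real \<Rightarrow> 'a::euclidean_space"
  assumes "f \<in> borel_measurable borel" "\<And>r. r \<in> {a..b} \<Longrightarrow> norm (f r) \<le> B"
  shows "f integrable_on {a..b}"
proof -
  have "f \<in> borel_measurable lebesgue"
    using assms(1) measurable_completion measurable_lborel2 by blast
  then show ?thesis
    using measurable_bounded_lemma[of f "\<lambda>_. B" a b] assms(2)
    by (simp add: integrable_continuous_interval)
qed

lemma integrable_bilinear_measurable_continuous:
  fixes p :: "'m::euclidean_space \<Rightarrow> 'a::euclidean_space \<Rightarrow> 'b::euclidean_space"
    and Y :: "real \<Rightarrow> 'a"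
  assumes p: "bounded_bilinear p"
    and f: "f \<in> borel_measurable borel" "\<And>r. norm (f r) \<le> K"
    and Y: "continuous_on {a..b} Y"
  shows "(\<lambda>r. p (f r) (Y r)) integrable_on {a..b}"
proof (cases "a \<le> b")
  case True
  \<comment> \<open>clamping \<open>Y\<close> to \<open>[a, b]\<close> makes it continuous, hence Borel, on the whole line\<close>
  define Y' where "Y' r = Y (max a (min b r))" for r
  have Y': "continuous_on UNIV Y'" "\<And>r. r \<in> {a..b} \<Longrightarrow> Y' r = Y r"
    unfolding Y'_def
    by (rule continuous_on_compose2[OF Y]) (use True in \<open>auto intro!: continuous_intros\<close>)
  obtain B where B: "\<And>r. r \<in> {a..b} \<Longrightarrow> norm (Y r) \<le> B"
    using compact_imp_bounded[OF compact_continuous_image[OF Y compact_Icc]]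
    unfolding bounded_iff by blast
  obtain Kp where "0 < Kp" and Kp: "\<And>x y. norm (p x y) \<le> norm x * norm y * Kp"
    using bounded_bilinear.pos_bounded[OF p] by blast
  have "(\<lambda>r. p (f r) (Y' r)) integrable_on {a..b}"
  proof (rule integrable_bounded_borel)
    have "Y' \<in> borel_measurable borel" using Y'(1) borel_measurable_continuous_onI by blast
    then show "(\<lambda>r. p (f r) (Y' r)) \<in> borel_measurable borel"
      by (intro borel_measurable_continuous_Pair[where H=p, OF f(1)]
          bounded_bilinear.continuous_on[OF p] continuous_intros)
    fix r assume r: "r \<in> {a..b}"
    have "norm (p (f r) (Y' r)) \<le> norm (f r) * norm (Y' r) * Kp" by (rule Kp)
    also have "\<dots> \<le> K * B * Kp"
      using f(2)[of r] B[OF r] Y'(2)[OF r] \<open>0 < Kp\<close>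
      by (intro mult_right_mono mult_mono) (auto intro: order_trans[OF norm_ge_zero])
    finally show "norm (p (f r) (Y' r)) \<le> K * B * Kp" .
  qed
  then show ?thesis by (rule integrable_eq) (use Y'(2) in auto)
qed (simp add: integrable_on_empty)

locale linear_ode =
  fixes p :: "'m::euclidean_space \<Rightarrow> 'a::euclidean_space \<Rightarrow> 'a" and M :: "real \<Rightarrow> 'm"
    and g :: "real \<Rightarrow> 'a" and K G :: real
  assumes bounded_bilinear: "bounded_bilinear p"
    and norm_p: "\<And>a x. norm (p a x) \<le> norm a * norm x"
    and M_measurable: "M \<in> borel_measurable borel" and g_measurable: "g \<in> borel_measurable borel"
    and norm_M: "\<And>r. norm (M r) \<le> K" and norm_g: "\<And>r. norm (g r) \<le> G"
begin

lemma K_nonneg: "0 \<le> K"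
  using norm_M[of 0] norm_ge_zero order_trans by blast

lemma G_nonneg: "0 \<le> G"
  using norm_g[of 0] norm_ge_zero order_trans by blast

lemma norm_p_M: "norm (p (M r) x) \<le> K * norm x"
  using norm_p[of "M r" x] norm_M[of r] by (meson mult_right_mono norm_ge_zero order_trans)

lemma norm_rhs: "norm (p (M r) x + g r) \<le> K * norm x + G"
  using norm_p_M[of r x] norm_g[of r] norm_triangle_ineq[of "p (M r) x" "g r"] by linarith

lemma norm_rhs_diff_le:
  "norm ((p (M r) x + g r) - (p (M' r) x' + g' r))
     \<le> K * norm (x - x') + (norm x' * norm (M r - M' r) + norm (g r - g' r))"
proof -
  have "(p (M r) x + g r) - (p (M' r) x' + g' r) = p (M r) (x - x') + p (M r - M' r) x' + (g r - g' r)"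
    by (simp add: bounded_bilinear.diff_right[OF bounded_bilinear]
        bounded_bilinear.diff_left[OF bounded_bilinear])
  also have "norm \<dots> \<le> norm (p (M r) (x - x')) + norm (p (M r - M' r) x') + norm (g r - g' r)"
    by (rule order_trans[OF norm_triangle_ineq add_right_mono[OF norm_triangle_ineq]])
  finally show ?thesis
    using norm_p_M[of r "x - x'"] norm_p[of "M r - M' r" x'] by (simp add: mult.commute)
qed

lemma p_M_integrable:
  "continuous_on {a..b} Y \<Longrightarrow> (\<lambda>r. p (M r) (Y r)) integrable_on {a..b}"
  by (rule integrable_bilinear_measurable_continuous[OF bounded_bilinear M_measurable norm_M])

lemma g_integrable: "g integrable_on {a..b}"
  by (rule integrable_bounded_borel[OF g_measurable norm_g])

lemma rhs_integrable:
  assumes "continuous_on {a..b} Y"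
  shows "(\<lambda>r. p (M r) (Y r) + g r) integrable_on {a..b}"
  by (intro integrable_add p_M_integrable g_integrable assms)

lemma solution_eq_integral:
  assumes "solves_from p M g s X" "s \<le> t"
  shows "X t = X s + integral {s..t} (\<lambda>r. p (M r) (X r) + g r)"
proof -
  have "((\<lambda>r. p (M r) (X r) + g r) has_integral (X t - X s)) {s..t}"
    using assms unfolding solves_from_def by blast
  then show ?thesis by (simp add: integral_unique)
qed

lemma continuous_on_solution:
  assumes X: "solves_from p M g s X"
  shows "continuous_on {s..T} X"
proof (cases "s \<le> T")
  case True
  have "(\<lambda>r. p (M r) (X r) + g r) integrable_on {s..T}"
    using X True unfolding solves_from_def by blast
  then have "continuous_on {s..T} (\<lambda>t. X s + integral {s..t} (\<lambda>r. p (M r) (X r) + g r))"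
    by (intro continuous_on_add continuous_on_const indefinite_integral_continuous_1)
  then show ?thesis
  proof (rule continuous_on_eq)
    fix t assume "t \<in> {s..T}"
    with solution_eq_integral[OF X, of t]
    show "X s + integral {s..t} (\<lambda>r. p (M r) (X r) + g r) = X t" by simp
  qed
qed simp

lemma solves_fromI:
  assumes cont: "continuous_on UNIV X"
    and eq: "\<And>t. s \<le> t \<Longrightarrow> X t = x0 + integral {s..t} (\<lambda>r. p (M r) (X r) + g r)"
  shows "solves_from p M g s X"
  unfolding solves_from_def
proof (intro allI impI)
  fix a b assume ab: "s \<le> a" "a \<le> b"
  let ?F = "\<lambda>r. p (M r) (X r) + g r"
  have "?F integrable_on {s..b}" "?F integrable_on {a..b}"
    by (auto intro!: rhs_integrable continuous_on_subset[OF cont])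
  moreover have combine: "integral {s..b} ?F = integral {s..a} ?F + integral {a..b} ?F"
    using ab calculation(1) by (intro Henstock_Kurzweil_Integration.integral_combine[symmetric]) auto
  ultimately show "(?F has_integral (X b - X a)) {a..b}"
    using eq[of a] eq[of b] ab by (simp add: integrable_integral combine)
qed

lemma solution_diff_eq_integral:
  assumes X: "solves_from p M g s X" and Y: "solves_from p M g s Y" and t: "s \<le> t"
  shows "X t - Y t = X s - Y s + integral {s..t} (\<lambda>r. p (M r) (X r - Y r))"
proof -
  have iX: "(\<lambda>r. p (M r) (X r)) integrable_on {s..t}" and iY: "(\<lambda>r. p (M r) (Y r)) integrable_on {s..t}"
    by (auto intro!: p_M_integrable continuous_on_solution X Y)
  have "X t - Y t = X s - Y s + (integral {s..t} (\<lambda>r. p (M r) (X r) + g r)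
                                 - integral {s..t} (\<lambda>r. p (M r) (Y r) + g r))"
    using solution_eq_integral[OF X t] solution_eq_integral[OF Y t] by simp
  also have "\<dots> = X s - Y s + integral {s..t} (\<lambda>r. p (M r) (X r) - p (M r) (Y r))"
    using iX iY g_integrable by (simp add: integral_add integral_diff)
  finally show ?thesis
    by (simp add: bounded_bilinear.diff_right[OF bounded_bilinear])
qed

lemma solution_unique:
  assumes X: "solves_from p M g s X" and Y: "solves_from p M g s Y" and eq: "X s = Y s"
    and t: "s \<le> t"
  shows "X t = Y t"
proof -
  have cX: "continuous_on {s..t} X" and cY: "continuous_on {s..t} Y"
    using continuous_on_solution X Y by auto
  have "norm (X t - Y t) \<le> 0 * exp (K * (t - s))"
  proof (rule gronwall[OF _ _ K_nonneg])
    show "continuous_on {s..t} (\<lambda>r. norm (X r - Y r))"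
      by (intro continuous_intros cX cY)
    fix r assume r: "r \<in> {s..t}"
    have cXr: "continuous_on {s..r} X" and cYr: "continuous_on {s..r} Y"
      using r by (auto intro: continuous_on_subset[OF cX] continuous_on_subset[OF cY])
    have "norm (X r - Y r) = norm (integral {s..r} (\<lambda>q. p (M q) (X q - Y q)))"
      using solution_diff_eq_integral[OF X Y, of r] r eq by simp
    also have "\<dots> \<le> integral {s..r} (\<lambda>q. K * norm (X q - Y q))"
      by (intro integral_norm_bound_integral p_M_integrable integrable_continuous_interval
          continuous_intros norm_p_M cXr cYr)
    finally show "norm (X r - Y r) \<le> 0 + K * integral {s..r} (\<lambda>q. norm (X q - Y q))" by simp
  qed (use t in auto)
  then show ?thesis by simp
qed

lemma norm_solution_le:
  assumes X: "solves_from p M g s X" and t: "s \<le> t"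
  shows "norm (X t) \<le> (norm (X s) + G * (t - s)) * exp (K * (t - s))"
proof (rule gronwall[where \<phi>="\<lambda>r. norm (X r)", OF _ _ K_nonneg])
  have cX: "continuous_on {s..t} X" by (rule continuous_on_solution[OF X])
  show "continuous_on {s..t} (\<lambda>r. norm (X r))" by (intro continuous_intros cX)
  fix r assume r: "r \<in> {s..t}"
  have ci: "continuous_on {s..r} X" using r by (auto intro: continuous_on_subset[OF cX])
  have "norm (X r) \<le> norm (X s) + norm (integral {s..r} (\<lambda>q. p (M q) (X q) + g q))"
    using solution_eq_integral[OF X, of r] r by (simp add: norm_triangle_ineq)
  also have "norm (integral {s..r} (\<lambda>q. p (M q) (X q) + g q)) \<le> integral {s..r} (\<lambda>q. K * norm (X q) + G)"
    by (intro integral_norm_bound_integral rhs_integrable integrable_continuous_interval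
        continuous_intros ci norm_rhs)
  also have "integral {s..r} (\<lambda>q. K * norm (X q) + G) = K * integral {s..r} (\<lambda>q. norm (X q)) + G * (r - s)"
    using r by (subst integral_add) (auto intro!: integrable_continuous_interval continuous_intros ci)
  finally show "norm (X r) \<le> norm (X s) + G * (t - s) + K * integral {s..r} (\<lambda>q. norm (X q))"
    using r G_nonneg mult_left_mono[of "r - s" "t - s" G] by auto
qed (use t in auto)

lemma solution_lipschitz:
  assumes X: "solves_from p M g s X" and tt: "s \<le> t" "t \<le> t'"
    and B: "\<And>r. r \<in> {t..t'} \<Longrightarrow> norm (X r) \<le> B"
  shows "norm (X t' - X t) \<le> (K * B + G) * (t' - t)"
proof -
  have hi: "((\<lambda>r. p (M r) (X r) + g r) has_integral (X t' - X t)) {t..t'}"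
    using X tt unfolding solves_from_def by auto
  have bound: "norm (p (M r) (X r) + g r) \<le> K * B + G" if "r \<in> {t..t'} - {}" for r
  proof -
    have "norm (X r) \<le> B" using B that by simp
    then have "K * norm (X r) \<le> K * B" using K_nonneg by (rule mult_left_mono)
    then show ?thesis using norm_rhs[of r "X r"] by linarith
  qed
  have "t \<in> {t..t'} - {}" using tt by simp
  then have "0 \<le> K * B + G" by (meson bound norm_ge_zero order_trans)
  from has_integral_bound_real[OF this finite.emptyI hi bound] tt show ?thesis by simp
qed

end

section \<open>Existence by Picard iteration\<close>

lemma has_integral_power_diff:
  fixes s t :: real assumes "s \<le> t"
  shows "((\<lambda>r. (r - s) ^ j) has_integral ((t - s) ^ Suc j / Suc j)) {s..t}"
proof -
  have "((\<lambda>r. (r - s) ^ Suc j / Suc j) has_real_derivative (r - s) ^ j) (at r within {s..t})" for r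
    by (auto intro!: derivative_eq_intros) (cases j; simp add: field_simps)
  from fundamental_theorem_of_calculus[OF assms, of "\<lambda>r. (r - s) ^ Suc j / Suc j"] this
  show ?thesis by (simp add: has_real_derivative_iff_has_vector_derivative)
qed

lemma continuous_on_UNIV_if_atMost:
  fixes f :: "real \<Rightarrow> 'b::topological_space"
  assumes "\<And>T. continuous_on {..T} f"
  shows "continuous_on UNIV f"
proof -
  have "isCont f t" for t
    using continuous_on_interior[OF assms[of "t + 1"], of t] by simp
  then show ?thesis by (simp add: continuous_on_eq_continuous_at)
qed

lemma continuous_on_integral_from_max:
  fixes F :: "real \<Rightarrow> 'b::banach"
  assumes "\<And>a b. F integrable_on {a..b}"
  shows "continuous_on UNIV (\<lambda>t. integral {s..max s t} F)"
proof (rule continuous_on_UNIV_if_atMost)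
  fix T
  show "continuous_on {..T} (\<lambda>t. integral {s..max s t} F)"
    by (rule continuous_on_compose2[OF indefinite_integral_continuous_1[OF assms, of s "max s T"]])
      (auto intro!: continuous_intros)
qed

context linear_ode
begin

lemma integral_p_M_tendsto:
  assumes lim: "uniform_limit {s..t} Y X sequentially"
    and cont: "\<And>n. continuous_on {s..t} (Y n)" "continuous_on {s..t} X" and st: "s \<le> t"
  shows "(\<lambda>n. integral {s..t} (\<lambda>r. p (M r) (Y n r))) \<longlonglongrightarrow> integral {s..t} (\<lambda>r. p (M r) (X r))"
proof (rule LIMSEQ_I)
  fix e :: real assume e: "0 < e"
  define e' where "e' = e / (K * (t - s) + 1)"
  have pos: "0 < K * (t - s) + 1" using K_nonneg st by (simp add: add_nonneg_pos)
  then have "0 < e'" using e by (simp add: e'_def)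
  then obtain N where N: "\<And>n r. n \<ge> N \<Longrightarrow> r \<in> {s..t} \<Longrightarrow> norm (Y n r - X r) < e'"
    using uniform_limitD[OF lim] by (fastforce simp: eventually_sequentially dist_norm)
  show "\<exists>N. \<forall>n\<ge>N. norm (integral {s..t} (\<lambda>r. p (M r) (Y n r)) - integral {s..t} (\<lambda>r. p (M r) (X r))) < e"
  proof (intro exI allI impI)
    fix n assume n: "N \<le> n"
    have "integral {s..t} (\<lambda>r. p (M r) (Y n r)) - integral {s..t} (\<lambda>r. p (M r) (X r))
        = integral {s..t} (\<lambda>r. p (M r) (Y n r - X r))"
      by (simp add: integral_diff[symmetric] p_M_integrable cont bounded_bilinear.diff_right[OF bounded_bilinear])
    also have "norm \<dots> \<le> integral {s..t} (\<lambda>r. K * e')"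
    proof (rule integral_norm_bound_integral)
      show "(\<lambda>r. p (M r) (Y n r - X r)) integrable_on {s..t}"
        by (intro p_M_integrable continuous_intros cont)
      fix r assume "r \<in> {s..t}"
      then show "norm (p (M r) (Y n r - X r)) \<le> K * e'"
        using norm_p_M[of r] N[OF n] K_nonneg by (meson less_imp_le mult_left_mono order_trans)
    qed auto
    also have "\<dots> = e * (K * (t - s)) / (K * (t - s) + 1)"
      using st by (simp add: e'_def)
    also have "\<dots> < e" using e pos by (simp add: field_simps)
    finally show "norm (integral {s..t} (\<lambda>r. p (M r) (Y n r)) - integral {s..t} (\<lambda>r. p (M r) (X r))) < e" .
  qed
qed

text \<open>Picard iterates, frozen at their initial value to the left of \<open>s\<close> so that they are
  continuous on the whole line.\<close>
primrec picard :: "'a \<Rightarrow> real \<Rightarrow> nat \<Rightarrow> real \<Rightarrow> 'a" where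
  "picard x0 s 0 = (\<lambda>t. x0)"
| "picard x0 s (Suc n) = (\<lambda>t. x0 + integral {s..max s t} (\<lambda>r. p (M r) (picard x0 s n r) + g r))"

lemma continuous_on_picard: "continuous_on UNIV (picard x0 s n)"
proof (induction n)
  case (Suc n)
  have "\<And>a b. (\<lambda>r. p (M r) (picard x0 s n r) + g r) integrable_on {a..b}"
    by (intro rhs_integrable continuous_on_subset[OF Suc.IH]) auto
  then show ?case by (simp only: picard.simps) (intro continuous_intros continuous_on_integral_from_max)
qed simp

lemma picard_Suc_diff:
  "picard x0 s (Suc (Suc n)) t - picard x0 s (Suc n) t
     = integral {s..max s t} (\<lambda>r. p (M r) (picard x0 s (Suc n) r - picard x0 s n r))"
proof -
  have "picard x0 s (Suc (Suc n)) t - picard x0 s (Suc n) t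
      = integral {s..max s t} (\<lambda>r. p (M r) (picard x0 s (Suc n) r) + g r)
        - integral {s..max s t} (\<lambda>r. p (M r) (picard x0 s n r) + g r)"
    by (simp only: picard.simps) simp
  also have "\<dots> = integral {s..max s t} (\<lambda>r. p (M r) (picard x0 s (Suc n) r - picard x0 s n r))"
    by (subst integral_diff[symmetric])
      (auto intro!: rhs_integrable continuous_on_subset[OF continuous_on_picard] simp del: picard.simps
        simp: bounded_bilinear.diff_right[OF bounded_bilinear])
  finally show ?thesis .
qed

lemma norm_picard_diff_le:
  "norm (picard x0 s (Suc n) t - picard x0 s n t)
     \<le> (K * norm x0 + G) * K ^ n * max 0 (t - s) ^ Suc n / fact (Suc n)"
proof (induction n arbitrary: t)
  case 0
  have hi: "((\<lambda>r. p (M r) x0 + g r) has_integral integral {s..max s t} (\<lambda>r. p (M r) x0 + g r))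
              {s..max s t}"
    by (simp add: integrable_integral rhs_integrable)
  have B: "0 \<le> K * norm x0 + G" using K_nonneg G_nonneg by simp
  have bound: "\<And>r. r \<in> {s..max s t} - {} \<Longrightarrow> norm (p (M r) x0 + g r) \<le> K * norm x0 + G"
    by (rule norm_rhs)
  have "norm (integral {s..max s t} (\<lambda>r. p (M r) x0 + g r)) \<le> (K * norm x0 + G) * (max s t - s)"
    using has_integral_bound_real[OF B finite.emptyI hi bound] by simp
  then show ?case by (cases "s \<le> t") (simp_all add: max_def)
next
  case (Suc n)
  let ?C = "(K * norm x0 + G) * K ^ n / fact (Suc n)"
  have hp: "((\<lambda>r. K * (?C * (r - s) ^ Suc n)) has_integral
              (K * (?C * ((max s t - s) ^ Suc (Suc n) / Suc (Suc n))))) {s..max s t}"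
    by (intro has_integral_mult_right has_integral_power_diff) simp
  have "norm (picard x0 s (Suc (Suc n)) t - picard x0 s (Suc n) t)
       \<le> integral {s..max s t} (\<lambda>r. K * (?C * (r - s) ^ Suc n))"
    unfolding picard_Suc_diff
  proof (rule integral_norm_bound_integral)
    show "(\<lambda>r. p (M r) (picard x0 s (Suc n) r - picard x0 s n r)) integrable_on {s..max s t}"
      by (intro p_M_integrable continuous_intros continuous_on_subset[OF continuous_on_picard]) auto
    show "(\<lambda>r. K * (?C * (r - s) ^ Suc n)) integrable_on {s..max s t}" using hp by blast
    fix r assume r: "r \<in> {s..max s t}"
    have "norm (p (M r) (picard x0 s (Suc n) r - picard x0 s n r))
          \<le> K * norm (picard x0 s (Suc n) r - picard x0 s n r)"
      by (rule norm_p_M)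
    also have "\<dots> \<le> K * (?C * (r - s) ^ Suc n)"
      using Suc.IH[of r] r K_nonneg by (intro mult_left_mono) (auto simp: max_def)
    finally show "norm (p (M r) (picard x0 s (Suc n) r - picard x0 s n r)) \<le> K * (?C * (r - s) ^ Suc n)" .
  qed
  also have "\<dots> = K * (?C * ((max s t - s) ^ Suc (Suc n) / Suc (Suc n)))"
    using hp by (rule integral_unique)
  also have "\<dots> = (K * norm x0 + G) * K ^ Suc n * max 0 (t - s) ^ Suc (Suc n) / fact (Suc (Suc n))"
  proof -
    have "fact (Suc (Suc n)) = real (Suc (Suc n)) * fact (Suc n)" by (simp only: fact_Suc)
    then have "K * (?C * (z ^ Suc (Suc n) / Suc (Suc n)))
               = (K * norm x0 + G) * K ^ Suc n * z ^ Suc (Suc n) / fact (Suc (Suc n))" for z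
      by (simp add: field_simps)
    moreover have "max s t - s = max 0 (t - s)" by (simp add: max_def)
    ultimately show ?thesis by presburger
  qed
  finally show ?case .
qed

definition picard_limit :: "'a \<Rightarrow> real \<Rightarrow> real \<Rightarrow> 'a" where
  "picard_limit x0 s t = x0 + (\<Sum>i. picard x0 s (Suc i) t - picard x0 s i t)"

lemma picard_uniform_limit:
  assumes sT: "s \<le> T"
  shows "uniform_limit {..T} (picard x0 s) (picard_limit x0 s) sequentially"
proof -
  define A where "A = K * norm x0 + G"
  have A: "0 \<le> A" using K_nonneg G_nonneg by (simp add: A_def)
  let ?D = "\<lambda>i. A * K ^ i * (T - s) ^ Suc i / fact (Suc i)"
  have bound: "norm (picard x0 s (Suc i) t - picard x0 s i t) \<le> ?D i" if "t \<in> {..T}" for i t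
  proof -
    have "norm (picard x0 s (Suc i) t - picard x0 s i t) \<le> A * K ^ i * max 0 (t - s) ^ Suc i / fact (Suc i)"
      using norm_picard_diff_le unfolding A_def .
    also have "\<dots> \<le> ?D i"
      using that A K_nonneg sT by (intro divide_right_mono mult_left_mono power_mono) auto
    finally show ?thesis .
  qed
  have "summable ?D"
  proof (rule summable_comparison_test')
    show "summable (\<lambda>i. A * (T - s) * (inverse (fact i) * (K * (T - s)) ^ i))"
      by (intro summable_mult summable_exp)
    fix i :: nat
    have "norm (?D i) = A * (T - s) * (K * (T - s)) ^ i / fact (Suc i)"
      using A K_nonneg sT by (simp add: power_mult_distrib)
    also have "\<dots> \<le> A * (T - s) * (K * (T - s)) ^ i / fact i"
      using A K_nonneg sT by (intro divide_left_mono mult_nonneg_nonneg) (auto simp: fact_mono)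
    finally show "norm (?D i) \<le> A * (T - s) * (inverse (fact i) * (K * (T - s)) ^ i)"
      by (simp add: field_simps)
  qed
  then have "uniform_limit {..T} (\<lambda>n t. x0 + (\<Sum>i<n. picard x0 s (Suc i) t - picard x0 s i t))
          (\<lambda>t. x0 + (\<Sum>i. picard x0 s (Suc i) t - picard x0 s i t)) sequentially"
    by (intro uniform_limit_add uniform_limit_const Weierstrass_m_test[OF bound])
  moreover have "(\<lambda>n t. x0 + (\<Sum>i<n. picard x0 s (Suc i) t - picard x0 s i t)) = picard x0 s"
  proof (intro ext)
    fix n t
    show "x0 + (\<Sum>i<n. picard x0 s (Suc i) t - picard x0 s i t) = picard x0 s n t"
      by (subst sum_lessThan_telescope[where f="\<lambda>i. picard x0 s i t"]) simp
  qed
  ultimately show ?thesis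
    unfolding picard_limit_def by simp
qed

lemma continuous_on_picard_limit: "continuous_on UNIV (picard_limit x0 s)"
proof (rule continuous_on_UNIV_if_atMost)
  fix T
  have "continuous_on {..max s T} (picard_limit x0 s)"
    using continuous_on_subset[OF continuous_on_picard]
    by (intro uniform_limit_theorem[OF always_eventually picard_uniform_limit]) auto
  then show "continuous_on {..T} (picard_limit x0 s)" by (rule continuous_on_subset) auto
qed

lemma picard_limit_eq_integral:
  assumes t: "s \<le> t"
  shows "picard_limit x0 s t = x0 + integral {s..t} (\<lambda>r. p (M r) (picard_limit x0 s r) + g r)"
proof -
  let ?X = "picard_limit x0 s" and ?I = "\<lambda>Y. integral {s..t} (\<lambda>r. p (M r) (Y r))"
  have split: "integral {s..t} (\<lambda>r. p (M r) (Y r) + g r) = ?I Y + integral {s..t} g"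
    if "continuous_on UNIV Y" for Y
    by (intro integral_add p_M_integrable g_integrable continuous_on_subset[OF that]) simp
  have U: "uniform_limit {..t} (picard x0 s) ?X sequentially"
    by (rule picard_uniform_limit[OF t])
  then have "uniform_limit {s..t} (picard x0 s) ?X sequentially"
    by (rule uniform_limit_on_subset) auto
  then have "(\<lambda>n. ?I (picard x0 s n)) \<longlonglongrightarrow> ?I ?X"
    using t by (intro integral_p_M_tendsto continuous_on_subset[OF continuous_on_picard]
        continuous_on_subset[OF continuous_on_picard_limit]) auto
  then have "(\<lambda>n. x0 + (?I (picard x0 s n) + integral {s..t} g)) \<longlonglongrightarrow> x0 + (?I ?X + integral {s..t} g)"
    by (intro tendsto_intros)
  moreover have "picard x0 s (Suc n) t = x0 + (?I (picard x0 s n) + integral {s..t} g)" for n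
    using t split[OF continuous_on_picard] by (simp add: max_absorb2)
  moreover have "(\<lambda>n. picard x0 s (Suc n) t) \<longlonglongrightarrow> ?X t"
    using LIMSEQ_Suc[OF tendsto_uniform_limitI[OF U, of t]] by (simp del: picard.simps)
  ultimately have "?X t = x0 + (?I ?X + integral {s..t} g)"
    using LIMSEQ_unique by auto
  then show ?thesis by (simp add: split[OF continuous_on_picard_limit])
qed

lemma solution_exists: "\<exists>X. solves_from p M g s X \<and> X s = x0"
proof (intro exI conjI)
  show "solves_from p M g s (picard_limit x0 s)"
    by (rule solves_fromI[OF continuous_on_picard_limit picard_limit_eq_integral])
  show "picard_limit x0 s s = x0"
    using picard_limit_eq_integral[of s s x0] by simp
qed

end

section \<open>Continuous dependence on the coefficients\<close>

lemma integrable_norm_diff_bounded: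
  fixes f f' :: "real \<Rightarrow> 'a::euclidean_space"
  assumes "f \<in> borel_measurable borel" "f' \<in> borel_measurable borel"
    and "\<And>r. norm (f r) \<le> K" "\<And>r. norm (f' r) \<le> K'"
  shows "(\<lambda>r. norm (f r - f' r)) integrable_on {a..b}"
proof (rule integrable_bounded_borel)
  show "(\<lambda>r. norm (f r - f' r)) \<in> borel_measurable borel" using assms(1,2) by measurable
  fix r show "norm (norm (f r - f' r)) \<le> K + K'"
    using norm_triangle_ineq4[of "f r" "f' r"] assms(3,4)[of r] by simp
qed

lemma solution_diff_integral_ineq:
  assumes L: "linear_ode p M g K G" and L': "linear_ode p M' g' K' G'"
    and X: "solves_from p M g 0 X" and X': "solves_from p M' g' 0 X'" and init: "X 0 = X' 0"
    and B: "\<And>r. r \<in> {0..T} \<Longrightarrow> norm (X' r) \<le> B" and r: "r \<in> {0..T}"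
  shows "norm (X r - X' r)
    \<le> (B * integral {0..T} (\<lambda>r. norm (M r - M' r)) + integral {0..T} (\<lambda>r. norm (g r - g' r)))
       + K * integral {0..r} (\<lambda>q. norm (X q - X' q))"
proof -
  interpret L: linear_ode p M g K G by (rule L)
  interpret L': linear_ode p M' g' K' G' by (rule L')
  have cX: "continuous_on {0..r} X" "continuous_on {0..r} X'"
    by (rule L.continuous_on_solution[OF X] L'.continuous_on_solution[OF X'])+
  have iM: "(\<lambda>r. norm (M r - M' r)) integrable_on {a..b}" for a b
    by (rule integrable_norm_diff_bounded[OF L.M_measurable L'.M_measurable L.norm_M L'.norm_M])
  have ig: "(\<lambda>r. norm (g r - g' r)) integrable_on {a..b}" for a b
    by (rule integrable_norm_diff_bounded[OF L.g_measurable L'.g_measurable L.norm_g L'.norm_g])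
  have iK: "(\<lambda>q. K * norm (X q - X' q)) integrable_on {0..r}"
    by (intro integrable_continuous_interval continuous_intros cX)
  have iB: "(\<lambda>q. B * norm (M q - M' q)) integrable_on {0..r}"
    using integrable_cmul[OF iM, of B] by simp
  let ?D = "\<lambda>q. (p (M q) (X q) + g q) - (p (M' q) (X' q) + g' q)"
  have "X r - X' r = integral {0..r} ?D"
    using L.solution_eq_integral[OF X, of r] L'.solution_eq_integral[OF X', of r] r init
    by (simp add: integral_diff L.rhs_integrable L'.rhs_integrable cX)
  also have "norm \<dots> \<le> integral {0..r} (\<lambda>q. K * norm (X q - X' q) + (B * norm (M q - M' q) + norm (g q - g' q)))"
  proof (rule integral_norm_bound_integral)
    show "?D integrable_on {0..r}" by (intro integrable_diff L.rhs_integrable L'.rhs_integrable cX)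
    show "(\<lambda>q. K * norm (X q - X' q) + (B * norm (M q - M' q) + norm (g q - g' q))) integrable_on {0..r}"
      by (intro integrable_add iK iB ig)
    fix q assume "q \<in> {0..r}"
    then have "norm (X' q) * norm (M q - M' q) \<le> B * norm (M q - M' q)"
      using B r by (intro mult_right_mono) auto
    then show "norm (?D q) \<le> K * norm (X q - X' q) + (B * norm (M q - M' q) + norm (g q - g' q))"
      using L.norm_rhs_diff_le[of q "X q" M' "X' q" g'] by linarith
  qed
  also have "\<dots> = K * integral {0..r} (\<lambda>q. norm (X q - X' q))
                + (B * integral {0..r} (\<lambda>q. norm (M q - M' q)) + integral {0..r} (\<lambda>q. norm (g q - g' q)))"
    by (simp add: integral_add iK iB ig integrable_add)
  also have "\<dots> \<le> K * integral {0..r} (\<lambda>q. norm (X q - X' q))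
                + (B * integral {0..T} (\<lambda>q. norm (M q - M' q)) + integral {0..T} (\<lambda>q. norm (g q - g' q)))"
    using r B[of 0] by (intro add_left_mono add_mono mult_left_mono integral_subset_le iM ig)
      (auto intro: order_trans[OF norm_ge_zero])
  finally show ?thesis by simp
qed

lemma solution_diff_le:
  assumes L: "linear_ode p M g K G" and L': "linear_ode p M' g' K' G'"
    and X: "solves_from p M g 0 X" and X': "solves_from p M' g' 0 X'" and init: "X 0 = X' 0"
    and B: "\<And>r. r \<in> {0..T} \<Longrightarrow> norm (X' r) \<le> B" and t: "t \<in> {0..T}"
  shows "norm (X t - X' t)
    \<le> (B * integral {0..T} (\<lambda>r. norm (M r - M' r)) + integral {0..T} (\<lambda>r. norm (g r - g' r))) * exp (K * T)"
    (is "_ \<le> ?\<epsilon> * _")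
proof -
  have K: "0 \<le> K" by (rule linear_ode.K_nonneg[OF L])
  have "norm (X t - X' t) \<le> ?\<epsilon> * exp (K * (t - 0))"
  proof (rule gronwall[OF _ _ K t])
    show "continuous_on {0..T} (\<lambda>t. norm (X t - X' t))"
      by (intro continuous_intros linear_ode.continuous_on_solution[OF L X] linear_ode.continuous_on_solution[OF L' X'])
  qed (rule solution_diff_integral_ineq[OF L L' X X' init B])
  also have "\<dots> \<le> ?\<epsilon> * exp (K * T)"
  proof (rule mult_left_mono)
    interpret L: linear_ode p M g K G by (rule L)
    interpret L': linear_ode p M' g' K' G' by (rule L')
    have "(\<lambda>r. norm (M r - M' r)) integrable_on {0..T}" "(\<lambda>r. norm (g r - g' r)) integrable_on {0..T}"
      by (rule integrable_norm_diff_bounded[OF L.M_measurable L'.M_measurable L.norm_M L'.norm_M]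
          integrable_norm_diff_bounded[OF L.g_measurable L'.g_measurable L.norm_g L'.norm_g])+
    then show "0 \<le> ?\<epsilon>"
      using B[of 0] t by (intro add_nonneg_nonneg mult_nonneg_nonneg integral_nonneg)
        (auto intro: order_trans[OF norm_ge_zero])
  qed (use t K in \<open>auto intro: mult_left_mono\<close>)
  finally show ?thesis .
qed

lemma solution_tendsto:
  assumes L: "\<And>k. linear_ode p (M k) (g k) K G" and L0: "linear_ode p M0 g0 K0 G0"
    and X: "\<And>k. solves_from p (M k) (g k) 0 (X k)" and X0: "solves_from p M0 g0 0 X0"
    and init: "\<And>k. X k 0 = X0 0"
    and M_lim: "(\<lambda>k. integral {0..T} (\<lambda>r. norm (M k r - M0 r))) \<longlonglongrightarrow> 0"
    and g_lim: "(\<lambda>k. integral {0..T} (\<lambda>r. norm (g k r - g0 r))) \<longlonglongrightarrow> 0"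
    and t_lim: "t \<longlonglongrightarrow> t0" and t0: "0 \<le> t0" "t0 < T" and t: "\<And>k. 0 \<le> t k"
  shows "(\<lambda>k. X k (t k)) \<longlonglongrightarrow> X0 t0"
proof -
  have cX0: "continuous_on {0..T} X0" by (rule linear_ode.continuous_on_solution[OF L0 X0])
  obtain B where B: "\<And>r. r \<in> {0..T} \<Longrightarrow> norm (X0 r) \<le> B"
    using compact_imp_bounded[OF compact_continuous_image[OF cX0 compact_Icc]]
    unfolding bounded_iff by blast
  define \<epsilon> where "\<epsilon> k = (B * integral {0..T} (\<lambda>r. norm (M k r - M0 r))
                         + integral {0..T} (\<lambda>r. norm (g k r - g0 r))) * exp (K * T)" for k
  have "\<epsilon> \<longlonglongrightarrow> (B * 0 + 0) * exp (K * T)"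
    unfolding \<epsilon>_def[abs_def] by (intro tendsto_intros M_lim g_lim)
  then have \<epsilon>: "\<epsilon> \<longlonglongrightarrow> 0" by simp
  have t_in: "\<forall>\<^sub>F k in sequentially. t k \<in> {0..T}"
    using order_tendstoD(2)[OF t_lim t0(2)] by eventually_elim (use t in \<open>auto simp: less_imp_le\<close>)
  have "(\<lambda>k. X k (t k) - X0 (t k)) \<longlonglongrightarrow> 0"
  proof (rule Lim_null_comparison[OF _ \<epsilon>])
    show "\<forall>\<^sub>F k in sequentially. norm (X k (t k) - X0 (t k)) \<le> \<epsilon> k"
      using t_in by eventually_elim (unfold \<epsilon>_def, rule solution_diff_le[OF L L0 X X0 init B])
  qed
  moreover have "(\<lambda>k. X0 (t k)) \<longlonglongrightarrow> X0 t0"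
    by (rule continuous_on_tendsto_compose[OF cX0 t_lim _ t_in]) (use t0 in auto)
  ultimately have "(\<lambda>k. (X k (t k) - X0 (t k)) + X0 (t k)) \<longlonglongrightarrow> 0 + X0 t0"
    by (rule tendsto_add)
  then show ?thesis by simp
qed

lemma integral_tendsto_0_if_dominated:
  fixes f g :: "nat \<Rightarrow> real \<Rightarrow> real"
  assumes "\<And>k. f k integrable_on S" "\<And>k. g k integrable_on S"
    and "\<And>k r. r \<in> S \<Longrightarrow> 0 \<le> f k r" "\<And>k r. r \<in> S \<Longrightarrow> f k r \<le> L * g k r"
    and "(\<lambda>k. integral S (g k)) \<longlonglongrightarrow> 0"
  shows "(\<lambda>k. integral S (f k)) \<longlonglongrightarrow> 0"
proof (rule tendsto_sandwich[of "\<lambda>_. 0" _ _ "\<lambda>k. L * integral S (g k)"])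
  show "\<forall>\<^sub>F k in sequentially. 0 \<le> integral S (f k)"
    using assms(1,3) by (auto intro!: always_eventually integral_nonneg)
  have "integral S (f k) \<le> integral S (\<lambda>r. L * g k r)" for k
    using integrable_cmul[OF assms(2), of L] assms(1,4) by (intro integral_le) auto
  then show "\<forall>\<^sub>F k in sequentially. integral S (f k) \<le> L * integral S (g k)" by simp
  show "(\<lambda>k. L * integral S (g k)) \<longlonglongrightarrow> 0" using tendsto_mult_right_zero[OF assms(5)] by simp
qed simp

section \<open>Superposition, translation and periodic extension\<close>

lemma solves_from_add_homogeneous:
  assumes p: "bounded_bilinear p"
    and X: "solves_from p M (\<lambda>_. 0) s X" and Y: "solves_from p M g s Y"
  shows "solves_from p M g s (\<lambda>r. X r + Y r)"
  unfolding solves_from_def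
proof (intro allI impI)
  fix a b assume "s \<le> a" "a \<le> b"
  then have "((\<lambda>r. p (M r) (X r) + 0) has_integral (X b - X a)) {a..b}"
    and "((\<lambda>r. p (M r) (Y r) + g r) has_integral (Y b - Y a)) {a..b}"
    using X Y unfolding solves_from_def by blast+
  from has_integral_add[OF this]
  show "((\<lambda>r. p (M r) (X r + Y r) + g r) has_integral (X b + Y b - (X a + Y a))) {a..b}"
    by (simp add: bounded_bilinear.add_right[OF p] algebra_simps)
qed

lemma solves_from_shift:
  assumes X: "solves_from p M g (s + \<tau>) X"
    and M: "\<And>r. M (r + \<tau>) = M r" and g: "\<And>r. g (r + \<tau>) = g r"
  shows "solves_from p M g s (\<lambda>r. X (r + \<tau>))"
  unfolding solves_from_def
proof (intro allI impI)
  fix a b assume "s \<le> a" "a \<le> b"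
  then have "((\<lambda>r. p (M r) (X r) + g r) has_integral (X (b + \<tau>) - X (a + \<tau>))) {a + \<tau>..b + \<tau>}"
    using X unfolding solves_from_def by auto
  from has_integral_shift_real_ivl[OF this, of \<tau>]
  show "((\<lambda>r. p (M r) (X (r + \<tau>)) + g r) has_integral (X (b + \<tau>) - X (a + \<tau>))) {a..b}"
    by (simp add: M g)
qed

lemma solves_from_cong:
  assumes "solves_from p M g s X" and "\<And>r. s \<le> r \<Longrightarrow> Y r = X r"
  shows "solves_from p M g s Y"
  using assms unfolding solves_from_def
  by (auto intro: has_integral_eq[where f="\<lambda>r. p (M r) (X r) + g r"])

lemma solves_from_mult_right:
  fixes X :: "real \<Rightarrow> real^'k^'n"
  assumes "solves_from (**) M (\<lambda>_. 0) s X"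
  shows "solves_from (**) M (\<lambda>_. 0) s (\<lambda>r. X r ** Y)"
  unfolding solves_from_def
proof (intro allI impI)
  fix a b assume "s \<le> a" "a \<le> b"
  then have "((\<lambda>r. M r ** X r + 0) has_integral (X b - X a)) {a..b}"
    using assms unfolding solves_from_def by blast
  then have "(((\<lambda>Z. Z ** Y) \<circ> (\<lambda>r. M r ** X r + 0)) has_integral ((X b - X a) ** Y)) {a..b}"
    by (rule has_integral_linear) (rule bounded_bilinear.bounded_linear_left[OF bounded_bilinear_matrix_mult])
  then
  show "((\<lambda>r. M r ** (X r ** Y) + 0) has_integral (X b ** Y - X a ** Y)) {a..b}"
    by (simp add: o_def matrix_mul_assoc bounded_bilinear.diff_left[OF bounded_bilinear_matrix_mult])
qed

lemma solves_from_mult_vector: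
  fixes X :: "real \<Rightarrow> real^'k^'n"
  assumes "solves_from (**) M (\<lambda>_. 0) s X"
  shows "solves_from (*v) M (\<lambda>_. 0) s (\<lambda>r. X r *v y)"
  unfolding solves_from_def
proof (intro allI impI)
  fix a b assume "s \<le> a" "a \<le> b"
  then have "((\<lambda>r. M r ** X r + 0) has_integral (X b - X a)) {a..b}"
    using assms unfolding solves_from_def by blast
  then have "(((\<lambda>Z. Z *v y) \<circ> (\<lambda>r. M r ** X r + 0)) has_integral ((X b - X a) *v y)) {a..b}"
    by (rule has_integral_linear) (rule bounded_bilinear.bounded_linear_left[OF bounded_bilinear_matrix_vector_mult])
  then
  show "((\<lambda>r. M r *v (X r *v y) + 0) has_integral (X b *v y - X a *v y)) {a..b}"
    by (simp add: o_def matrix_vector_mul_assoc matrix_vector_mult_diff_rdistrib)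
qed

lemma periodic_add_nat_mult:
  assumes "\<And>t. f (t + \<tau>) = f t"
  shows "f (t + real n * \<tau>) = f t"
proof (induction n)
  case (Suc n)
  have "t + real (Suc n) * \<tau> = (t + real n * \<tau>) + \<tau>" by (simp add: algebra_simps)
  then show ?case by (simp only: assms Suc.IH)
qed simp

definition periodic_extension :: "real \<Rightarrow> (real \<Rightarrow> 'a) \<Rightarrow> real \<Rightarrow> 'a" where
  "periodic_extension \<tau> X t = X (t - of_int \<lfloor>t / \<tau>\<rfloor> * \<tau>)"

lemma periodic_extension_add:
  assumes "0 < \<tau>"
  shows "periodic_extension \<tau> X (t + \<tau>) = periodic_extension \<tau> X t"
proof -
  have "(t + \<tau>) / \<tau> = t / \<tau> + 1" using assms by (simp add: field_simps)
  then show ?thesis unfolding periodic_extension_def by (simp add: algebra_simps)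
qed

lemma periodic_extension_eq:
  assumes \<tau>: "0 < \<tau>" and per: "\<And>t. 0 \<le> t \<Longrightarrow> X (t + \<tau>) = X t" and t: "0 \<le> t"
  shows "periodic_extension \<tau> X t = X t"
proof -
  have iter: "X (q + real n * \<tau>) = X q" if "0 \<le> q" for q n
  proof (induction n)
    case (Suc n)
    have "q + real (Suc n) * \<tau> = (q + real n * \<tau>) + \<tau>" by (simp add: algebra_simps)
    then show ?case using per[of "q + real n * \<tau>"] Suc that \<tau> by (simp add: algebra_simps)
  qed simp
  define q where "q = t - of_int \<lfloor>t / \<tau>\<rfloor> * \<tau>"
  have "0 \<le> q" unfolding q_def using floor_divide_lower[OF \<tau>, of t] by simp
  moreover have "q + real (nat \<lfloor>t / \<tau>\<rfloor>) * \<tau> = t" unfolding q_def using t \<tau> by simp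
  ultimately have "X t = X q" by (metis iter)
  then show ?thesis unfolding periodic_extension_def q_def by simp
qed

section \<open>Perturbed singular linear systems\<close>

lemma small_image_imp_near_kernel:
  fixes N :: "real^'n^'m"
  assumes e: "0 < \<epsilon>"
  shows "\<exists>\<eta>>0. \<forall>y. norm y = 1 \<longrightarrow> norm (N *v y) < \<eta> \<longrightarrow> infdist y {v. N *v v = 0} < \<epsilon>"
proof -
  let ?W = "{v. N *v v = 0}"
  \<comment> \<open>the unit vectors at distance \<open>\<ge> \<epsilon>\<close> from the kernel form a compact set on which \<open>N\<close> does not vanish\<close>
  let ?S = "sphere (0::real^'n) 1 \<inter> {y. \<epsilon> \<le> infdist y ?W}"
  show ?thesis
  proof (cases "?S = {}")
    case True
    then show ?thesis by (intro exI[of _ 1]) (auto simp: not_le)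
  next
    case False
    have "compact ?S"
      by (intro compact_Int_closed compact_sphere closed_Collect_le continuous_on_const
          continuous_on_infdist continuous_on_id)
    moreover have "continuous_on ?S (\<lambda>y. norm (N *v y))"
      by (intro continuous_intros linear_continuous_on) simp
    ultimately obtain y0 where y0: "y0 \<in> ?S" and min: "\<And>y. y \<in> ?S \<Longrightarrow> norm (N *v y0) \<le> norm (N *v y)"
      using continuous_attains_inf[OF _ False] by blast
    have "closed ?W" by (intro closed_subspace linear_subspace_kernel) simp
    then have "N *v y0 \<noteq> 0"
      using y0 e in_closed_iff_infdist_zero[of ?W y0] by (force simp: infdist_nonneg)
    show ?thesis
    proof (intro exI[of _ "norm (N *v y0)"] conjI allI impI)
      show "0 < norm (N *v y0)" using \<open>N *v y0 \<noteq> 0\<close> by simp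
      fix y :: "real^'n" assume y: "norm y = 1" "norm (N *v y) < norm (N *v y0)"
      show "infdist y ?W < \<epsilon>"
      proof (rule ccontr)
        assume "\<not> infdist y ?W < \<epsilon>"
        then have "y \<in> ?S" using y by auto
        from min[OF this] y(2) show False by simp
      qed
    qed
  qed
qed

lemma norm_solution_tendsto_infinity:
  fixes N :: "nat \<Rightarrow> real^'n^'m"
  assumes N: "N \<longlonglongrightarrow> N0" and b: "b \<longlonglongrightarrow> b0"
    and eq: "\<forall>\<^sub>F k in sequentially. N k *v x k = b k"
    and unsolvable: "b0 \<notin> range (\<lambda>y. N0 *v y)"
  shows "filterlim (\<lambda>k. norm (x k)) at_top sequentially"
  unfolding filterlim_at_top
proof
  fix R :: real
  define R' where "R' = max R 0"
  have "closed (range (\<lambda>y. N0 *v y))"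
    by (intro closed_subspace linear_subspace_image subspace_UNIV) simp
  then have "infdist b0 (range (\<lambda>y. N0 *v y)) \<noteq> 0"
    using unsolvable in_closed_iff_infdist_zero[of _ b0] by blast
  then have \<delta>: "0 < infdist b0 (range (\<lambda>y. N0 *v y))"
    using infdist_nonneg[of b0 "range (\<lambda>y. N0 *v y)"] by linarith
  have "(\<lambda>k. norm (N k - N0) * R' + norm (b k - b0)) \<longlonglongrightarrow> 0 * R' + 0"
    using N b by (intro tendsto_intros) (simp_all add: tendsto_norm_zero_iff LIM_zero)
  then have "\<forall>\<^sub>F k in sequentially. norm (N k - N0) * R' + norm (b k - b0) < infdist b0 (range (\<lambda>y. N0 *v y))"
    using \<delta> by (intro order_tendstoD(2)) auto
  with eq show "\<forall>\<^sub>F k in sequentially. R \<le> norm (x k)"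
  proof eventually_elim
    case (elim k)
    \<comment> \<open>a bounded \<open>x k\<close> would make \<open>N0 *v x k\<close> close to \<open>b0\<close>\<close>
    show ?case
    proof (rule ccontr)
      assume "\<not> R \<le> norm (x k)"
      then have xR: "norm (x k) \<le> R'" unfolding R'_def by simp
      have "infdist b0 (range (\<lambda>y. N0 *v y)) \<le> dist b0 (N0 *v x k)" by (rule infdist_le) auto
      also have "\<dots> = norm ((N k - N0) *v x k - (b k - b0))"
        using elim(1) by (simp add: dist_norm matrix_vector_mult_diff_rdistrib norm_minus_commute algebra_simps)
      also have "\<dots> \<le> norm (N k - N0) * norm (x k) + norm (b k - b0)"
        by (rule order_trans[OF norm_triangle_ineq4 add_right_mono[OF norm_matrix_vector_mult_le]])
      also have "\<dots> \<le> norm (N k - N0) * R' + norm (b k - b0)"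
        using xR by (simp add: mult_left_mono)
      finally show False using elim(2) by simp
    qed
  qed
qed

lemma direction_tendsto_kernel:
  fixes N :: "nat \<Rightarrow> real^'n^'m"
  assumes N: "N \<longlonglongrightarrow> N0" and b: "b \<longlonglongrightarrow> b0"
    and eq: "\<forall>\<^sub>F k in sequentially. N k *v x k = b k"
    and x: "filterlim (\<lambda>k. norm (x k)) at_top sequentially"
  shows "(\<lambda>k. infdist (x k /\<^sub>R norm (x k)) {v. N0 *v v = 0}) \<longlonglongrightarrow> 0"
proof (rule LIMSEQ_I)
  fix \<epsilon> :: real assume "0 < \<epsilon>"
  then obtain \<eta> where "0 < \<eta>"
    and \<eta>: "\<And>y. norm y = 1 \<Longrightarrow> norm (N0 *v y) < \<eta> \<Longrightarrow> infdist y {v. N0 *v v = 0} < \<epsilon>"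
    using small_image_imp_near_kernel by blast
  have "(\<lambda>k. norm (b k) * inverse (norm (x k)) + norm (N k - N0)) \<longlonglongrightarrow> norm b0 * 0 + 0"
    using N by (intro tendsto_intros b tendsto_inverse_0_at_top x) (simp add: tendsto_norm_zero_iff LIM_zero)
  then have "\<forall>\<^sub>F k in sequentially. norm (b k) * inverse (norm (x k)) + norm (N k - N0) < \<eta>"
    using \<open>0 < \<eta>\<close> by (intro order_tendstoD(2)) auto
  moreover have "\<forall>\<^sub>F k in sequentially. 1 \<le> norm (x k)" using x unfolding filterlim_at_top by blast
  ultimately have "\<forall>\<^sub>F k in sequentially. norm (infdist (x k /\<^sub>R norm (x k)) {v. N0 *v v = 0} - 0) < \<epsilon>"
    using eq
  proof eventually_elim
    case (elim k)
    define y where "y = x k /\<^sub>R norm (x k)"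
    have nx: "0 < norm (x k)" using elim(2) by linarith
    have ny: "norm y = 1" unfolding y_def using nx by simp
    have "N k *v y = b k /\<^sub>R norm (x k)"
      using elim(3) by (simp add: y_def matrix_vector_mult_scaleR)
    then have "N0 *v y = b k /\<^sub>R norm (x k) - (N k - N0) *v y"
      by (simp add: matrix_vector_mult_diff_rdistrib)
    then have "norm (N0 *v y) \<le> norm (b k) * inverse (norm (x k)) + norm (N k - N0)"
      using norm_triangle_ineq4[of "b k /\<^sub>R norm (x k)" "(N k - N0) *v y"]
        norm_matrix_vector_mult_le[of "N k - N0" y] ny nx
      by (simp add: mult.commute)
    then have "infdist y {v. N0 *v v = 0} < \<epsilon>" using \<eta>[OF ny] elim(1) by simp
    then show ?case unfolding y_def by (simp add: infdist_nonneg)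
  qed
  then show "\<exists>no. \<forall>k\<ge>no. norm (infdist (x k /\<^sub>R norm (x k)) {v. N0 *v v = 0} - 0) < \<epsilon>"
    by (simp add: eventually_sequentially)
qed

section \<open>The controlled system\<close>

lemma continuous_on_Amat: "continuous_on UNIV (Amat A B)"
proof -
  have "linear (\<lambda>w. \<Sum>i\<in>UNIV. (w $ i) *\<^sub>R B i)"
    by (auto simp: linear_iff sum.distrib scaleR_add_left scaleR_sum_right algebra_simps)
  then show ?thesis
    unfolding Amat_def by (intro continuous_intros linear_continuous_on linear_conv_bounded_linear[THEN iffD1])
qed

lemma norm_Amat_diff_le: "norm (Amat A B w - Amat A B w') \<le> norm (w - w') * (\<Sum>i\<in>UNIV. norm (B i))"
proof -
  have "Amat A B w - Amat A B w' = (\<Sum>i\<in>UNIV. ((w - w') $ i) *\<^sub>R B i)"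
    by (simp add: Amat_def sum_subtractf scaleR_diff_left)
  also have "norm \<dots> \<le> (\<Sum>i\<in>UNIV. norm (((w - w') $ i) *\<^sub>R B i))" by (rule norm_sum)
  also have "\<dots> \<le> (\<Sum>i\<in>UNIV. norm (w - w') * norm (B i))"
    using component_le_norm_cart[of "w - w'"] by (intro sum_mono) (auto intro!: mult_right_mono)
  finally show ?thesis by (simp add: sum_distrib_left)
qed

lemma norm_Amat_le: "norm w \<le> c \<Longrightarrow> norm (Amat A B w) \<le> norm A + c * (\<Sum>i\<in>UNIV. norm (B i))"
  using norm_Amat_diff_le[of A B w 0] norm_triangle_ineq[of A "Amat A B w - A"]
    mult_right_mono[of "norm w" c "\<Sum>i\<in>UNIV. norm (B i)"]
  by (simp add: Amat_def sum_nonneg)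

locale control_system =
  fixes A :: "real^'n^'n" and B :: "'m::finite \<Rightarrow> real^'n^'n" and C :: "real^'m^'n"
    and d :: "real^'n" and c :: real
begin

definition admissible :: "(real \<Rightarrow> real^'m) \<Rightarrow> bool" where
  "admissible u \<longleftrightarrow> u \<in> borel_measurable borel \<and> (\<forall>t. norm (u t) \<le> c)"

definition coef :: "(real \<Rightarrow> real^'m) \<Rightarrow> real \<Rightarrow> real^'n^'n" where
  "coef u r = Amat A B (u r)"

definition forcing :: "(real \<Rightarrow> real^'m) \<Rightarrow> real \<Rightarrow> real^'n" where
  "forcing u r = C *v u r + d"

definition coef_bound :: real where
  "coef_bound = norm A + c * (\<Sum>i\<in>UNIV. norm (B i))"

definition forcing_bound :: real where
  "forcing_bound = norm C * c + norm d"

lemma coef_measurable: "admissible u \<Longrightarrow> coef u \<in> borel_measurable borel"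
  unfolding admissible_def coef_def[abs_def]
  by (intro borel_measurable_continuous_on[OF continuous_on_Amat]) auto

lemma norm_coef: "admissible u \<Longrightarrow> norm (coef u r) \<le> coef_bound"
  unfolding admissible_def coef_def coef_bound_def by (intro norm_Amat_le) auto

lemma forcing_measurable: "admissible u \<Longrightarrow> forcing u \<in> borel_measurable borel"
  unfolding admissible_def forcing_def[abs_def]
  by (intro borel_measurable_continuous_on[where f="\<lambda>w. C *v w + d"] continuous_intros
      linear_continuous_on) auto

lemma norm_forcing: "admissible u \<Longrightarrow> norm (forcing u r) \<le> forcing_bound"
proof -
  assume "admissible u"
  then have "norm C * norm (u r) \<le> norm C * c" by (simp add: admissible_def mult_left_mono)
  then show ?thesis
    using norm_matrix_vector_mult_le[of C "u r"] norm_triangle_ineq[of "C *v u r" d]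
    unfolding forcing_def forcing_bound_def by linarith
qed

lemma matrix_ode:
  "admissible u \<Longrightarrow> linear_ode (**) (coef u) (\<lambda>_. 0 :: real^'n^'n) coef_bound 0"
  by (rule linear_ode.intro) (auto intro: bounded_bilinear_matrix_mult norm_matrix_mult_le coef_measurable norm_coef)

lemma vector_ode:
  "admissible u \<Longrightarrow> linear_ode (*v) (coef u) (forcing u) coef_bound forcing_bound"
  by (intro linear_ode.intro bounded_bilinear_matrix_vector_mult norm_matrix_vector_mult_le
      coef_measurable norm_coef forcing_measurable norm_forcing)

text \<open>The principal fundamental solution \<open>\<Phi>\<^sub>u(t, s)\<close> is \<open>Phi u s t\<close>, and \<open>particular u\<close> is the
  solution of the inhomogeneous system with \<open>x(0) = 0\<close>.\<close>
definition Phi :: "(real \<Rightarrow> real^'m) \<Rightarrow> real \<Rightarrow> real \<Rightarrow> real^'n^'n" where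
  "Phi u s = (SOME X. solves_from (**) (coef u) (\<lambda>_. 0) s X \<and> X s = mat 1)"

definition particular :: "(real \<Rightarrow> real^'m) \<Rightarrow> real \<Rightarrow> real^'n" where
  "particular u = (SOME X. solves_from (*v) (coef u) (forcing u) 0 X \<and> X 0 = 0)"

lemma
  assumes "admissible u"
  shows Phi_solves: "solves_from (**) (coef u) (\<lambda>_. 0) s (Phi u s)"
    and Phi_same [simp]: "Phi u s s = mat 1"
proof -
  interpret linear_ode "(**)" "coef u" "\<lambda>_. 0 :: real^'n^'n" coef_bound 0 by (rule matrix_ode[OF assms])
  from someI_ex[OF solution_exists[of s "mat 1"]]
  show "solves_from (**) (coef u) (\<lambda>_. 0) s (Phi u s)" "Phi u s s = mat 1"
    unfolding Phi_def by auto
qed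

lemma
  assumes "admissible u"
  shows particular_solves: "solves_from (*v) (coef u) (forcing u) 0 (particular u)"
    and particular_0 [simp]: "particular u 0 = 0"
proof -
  interpret linear_ode "(*v)" "coef u" "forcing u" coef_bound forcing_bound by (rule vector_ode[OF assms])
  from someI_ex[OF solution_exists[of 0 0]]
  show "solves_from (*v) (coef u) (forcing u) 0 (particular u)" "particular u 0 = 0"
    unfolding particular_def by auto
qed

lemma fundsol_eq_Phi:
  assumes u: "admissible u" and st: "s \<le> t"
  shows "fundsol A B u t s = Phi u s t"
  unfolding fundsol_def
proof (rule the_equality)
  interpret linear_ode "(**)" "coef u" "\<lambda>_. 0 :: real^'n^'n" coef_bound 0 by (rule matrix_ode[OF u])
  have sol_iff: "(\<forall>a b. s \<le> a \<longrightarrow> a \<le> b \<longrightarrow> ((\<lambda>r. Amat A B (u r) ** \<Phi> r) has_integral (\<Phi> b - \<Phi> a)) {a..b})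
      \<longleftrightarrow> solves_from (**) (coef u) (\<lambda>_. 0) s \<Phi>" for \<Phi>
    by (simp add: solves_from_def coef_def)
  show "\<exists>\<Phi>. \<Phi> s = mat 1 \<and> (\<forall>a b. s \<le> a \<longrightarrow> a \<le> b \<longrightarrow>
          ((\<lambda>r. Amat A B (u r) ** \<Phi> r) has_integral (\<Phi> b - \<Phi> a)) {a..b}) \<and> \<Phi> t = Phi u s t"
    using Phi_solves[OF u, of s] Phi_same[OF u] sol_iff by (intro exI[of _ "Phi u s"]) auto
  fix M' assume "\<exists>\<Phi>. \<Phi> s = mat 1 \<and> (\<forall>a b. s \<le> a \<longrightarrow> a \<le> b \<longrightarrow>
          ((\<lambda>r. Amat A B (u r) ** \<Phi> r) has_integral (\<Phi> b - \<Phi> a)) {a..b}) \<and> \<Phi> t = M'"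
  then obtain \<Phi> where "\<Phi> s = mat 1" "solves_from (**) (coef u) (\<lambda>_. 0) s \<Phi>" "\<Phi> t = M'"
    using sol_iff by blast
  then show "M' = Phi u s t"
    using solution_unique[OF _ Phi_solves[OF u] _ st] u by auto
qed

subsection \<open>Periodic solutions\<close>

lemma is_solution_iff: "is_solution A B C d u x \<longleftrightarrow> (\<forall>s. solves_from (*v) (coef u) (forcing u) s x)"
  unfolding is_solution_def solves_from_def coef_def forcing_def
  by (auto simp: add.assoc intro: order_refl)

lemma Phi_compose:
  assumes u: "admissible u" and st: "s \<le> t" and tr: "t \<le> r"
  shows "Phi u s r = Phi u t r ** Phi u s t"
proof -
  interpret linear_ode "(**)" "coef u" "\<lambda>_. 0 :: real^'n^'n" coef_bound 0 by (rule matrix_ode[OF u])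
  show ?thesis
    using solution_unique[OF solves_from_mono[OF Phi_solves[OF u] st]
        solves_from_mult_right[OF Phi_solves[OF u]] _ tr] u
    by simp
qed

lemma solves_from_Phi_affine:
  assumes u: "admissible u"
  shows "solves_from (*v) (coef u) (forcing u) 0 (\<lambda>r. Phi u 0 r *v v + particular u r)"
  by (intro solves_from_add_homogeneous bounded_bilinear_matrix_vector_mult
      solves_from_mult_vector Phi_solves particular_solves u)

lemma solution_eq_Phi:
  assumes u: "admissible u" and x: "solves_from (*v) (coef u) (forcing u) 0 x" and t: "0 \<le> t"
  shows "x t = Phi u 0 t *v x 0 + particular u t"
proof -
  interpret linear_ode "(*v)" "coef u" "forcing u" coef_bound forcing_bound by (rule vector_ode[OF u])
  show ?thesis
    using solution_unique[OF x solves_from_Phi_affine[OF u] _ t] u by simp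
qed

lemma periodic_solution_initial:
  assumes u: "admissible u" and x: "is_periodic_solution A B C d u \<tau> x" and \<tau>: "0 < \<tau>"
  shows "(mat 1 - Phi u 0 \<tau>) *v x 0 = particular u \<tau>"
proof -
  have "x \<tau> = Phi u 0 \<tau> *v x 0 + particular u \<tau>"
    using x \<tau> solution_eq_Phi[OF u] unfolding is_periodic_solution_def is_solution_iff by simp
  moreover have "x \<tau> = x 0" using x unfolding is_periodic_solution_def by (metis add_0)
  ultimately have "x 0 - Phi u 0 \<tau> *v x 0 = particular u \<tau>" by (metis add_diff_cancel_left')
  then show ?thesis by (simp add: matrix_vector_mult_diff_rdistrib)
qed

text \<open>A solution on \<open>[0, \<infinity>)\<close> with \<open>x(\<tau>) = x(0)\<close> is \<open>\<tau>\<close>-periodic there by uniqueness, and its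
  periodic extension solves the system on the whole line.\<close>
lemma periodic_solution_from_closed_orbit:
  assumes u: "admissible u" and \<tau>: "0 < \<tau>" and u_per: "\<And>t. u (t + \<tau>) = u t"
    and X: "solves_from (*v) (coef u) (forcing u) 0 X" and X\<tau>: "X \<tau> = X 0"
  obtains Z where "is_periodic_solution A B C d u \<tau> Z" and "\<And>t. 0 \<le> t \<Longrightarrow> Z t = X t"
proof -
  interpret linear_ode "(*v)" "coef u" "forcing u" coef_bound forcing_bound by (rule vector_ode[OF u])
  have coef_per: "coef u (r + \<tau>) = coef u r" and forcing_per: "forcing u (r + \<tau>) = forcing u r" for r
    by (simp_all add: coef_def forcing_def u_per)
  have "solves_from (*v) (coef u) (forcing u) 0 (\<lambda>r. X (r + \<tau>))"
    using solves_from_mono[OF X, of "0 + \<tau>"] \<tau> by (intro solves_from_shift coef_per forcing_per) auto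
  then have X_per: "X (t + \<tau>) = X t" if "0 \<le> t" for t
    using solution_unique[OF _ X _ that] X\<tau> by simp
  define Z where "Z = periodic_extension \<tau> X"
  have Z_per: "Z (t + \<tau>) = Z t" and Z_eq: "0 \<le> t \<Longrightarrow> Z t = X t" for t
    unfolding Z_def using periodic_extension_add[OF \<tau>] periodic_extension_eq[of \<tau> X, OF \<tau> X_per] by blast+
  have Z_sol0: "solves_from (*v) (coef u) (forcing u) 0 Z"
    using solves_from_cong[OF X Z_eq] by simp
  have "solves_from (*v) (coef u) (forcing u) s Z" for s
  proof -
    obtain n :: nat where n: "- s < real n * \<tau>" using reals_Archimedean3[OF \<tau>] by blast
    have "solves_from (*v) (coef u) (forcing u) (- real n * \<tau>) (\<lambda>r. Z (r + real n * \<tau>))"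
      by (intro solves_from_shift) (auto simp: Z_sol0 periodic_add_nat_mult coef_per forcing_per)
    then have "solves_from (*v) (coef u) (forcing u) (- real n * \<tau>) Z"
      by (simp add: periodic_add_nat_mult[of Z, OF Z_per])
    then show ?thesis by (rule solves_from_mono) (use n in simp)
  qed
  then show ?thesis
    using that[of Z] Z_per Z_eq unfolding is_periodic_solution_def is_solution_iff by blast
qed

lemma periodic_solution_unique:
  assumes u: "admissible u" and \<tau>: "0 < \<tau>"
    and x: "is_periodic_solution A B C d u \<tau> x" and y: "is_periodic_solution A B C d u \<tau> y"
    and eq0: "x 0 = y 0"
  shows "x = y"
proof
  fix t
  obtain n :: nat where n: "- t < real n * \<tau>" using reals_Archimedean3[OF \<tau>] by blast
  have per: "x (r + \<tau>) = x r" "y (r + \<tau>) = y r" for r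
    using x y unfolding is_periodic_solution_def by blast+
  have "solves_from (*v) (coef u) (forcing u) 0 x" "solves_from (*v) (coef u) (forcing u) 0 y"
    using x y unfolding is_periodic_solution_def is_solution_iff by blast+
  then have "x (t + real n * \<tau>) = y (t + real n * \<tau>)"
    using solution_eq_Phi[OF u, of x "t + real n * \<tau>"] solution_eq_Phi[OF u, of y "t + real n * \<tau>"] n eq0
    by simp
  then show "x t = y t"
    by (simp add: periodic_add_nat_mult[of x, OF per(1)] periodic_add_nat_mult[of y, OF per(2)])
qed

lemma periodic_solution_ex1:
  assumes u: "admissible u" and \<tau>: "0 < \<tau>" and u_per: "\<And>t. u (t + \<tau>) = u t"
    and not_one: "\<not> one_in_spec (Phi u 0 \<tau>)"
  shows "\<exists>!x. is_periodic_solution A B C d u \<tau> x"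
proof -
  let ?L = "\<lambda>v. (mat 1 - Phi u 0 \<tau>) *v v"
  have "inj ?L"
  proof (rule injI)
    fix x y assume "?L x = ?L y"
    then have "Phi u 0 \<tau> *v (x - y) = x - y"
      by (simp add: matrix_vector_mult_diff_rdistrib matrix_vector_mult_diff_distrib algebra_simps)
    then show "x = y" using not_one unfolding one_in_spec_def by (metis eq_iff_diff_eq_0)
  qed
  then obtain x0 where x0: "?L x0 = particular u \<tau>"
    using linear_injective_imp_surjective[of ?L] by (metis surjD matrix_vector_mul_linear)
  define X where "X r = Phi u 0 r *v x0 + particular u r" for r
  have X: "solves_from (*v) (coef u) (forcing u) 0 X"
    unfolding X_def[abs_def] by (rule solves_from_Phi_affine[OF u])
  have "X \<tau> = X 0"
    using x0 u unfolding X_def by (simp add: matrix_vector_mult_diff_rdistrib algebra_simps)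
  then obtain Z where Z: "is_periodic_solution A B C d u \<tau> Z" and "\<And>t. 0 \<le> t \<Longrightarrow> Z t = X t"
    using periodic_solution_from_closed_orbit[OF u \<tau> u_per X] by blast
  then have Z0: "Z 0 = x0" using u by (simp add: X_def)
  show ?thesis
  proof (rule ex1I[of _ Z])
    show "is_periodic_solution A B C d u \<tau> Z" by (rule Z)
  next
    fix y assume y: "is_periodic_solution A B C d u \<tau> y"
    have "?L (y 0) = ?L (Z 0)" using periodic_solution_initial[OF u y \<tau>] x0 Z0 by simp
    then show "y = Z" using periodic_solution_unique[OF u \<tau> y Z] \<open>inj ?L\<close> by (simp add: inj_eq)
  qed
qed

subsection \<open>Variation of constants\<close>

lemma coef_bound_nonneg: "admissible u \<Longrightarrow> 0 \<le> coef_bound"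
  using linear_ode.K_nonneg[OF vector_ode] .

lemma forcing_bound_nonneg: "admissible u \<Longrightarrow> 0 \<le> forcing_bound"
  using linear_ode.G_nonneg[OF vector_ode] .

lemma Phi_bounds:
  assumes u: "admissible u"
  obtains P L where "0 \<le> P" "0 \<le> L"
    "\<And>s r. 0 \<le> s \<Longrightarrow> s \<le> r \<Longrightarrow> r \<le> \<tau> \<Longrightarrow> norm (Phi u s r) \<le> P"
    "\<And>s r. 0 \<le> s \<Longrightarrow> s \<le> r \<Longrightarrow> r \<le> \<tau> \<Longrightarrow> norm (Phi u s r - mat 1) \<le> L * (r - s)"
proof -
  interpret linear_ode "(**)" "coef u" "\<lambda>_. 0 :: real^'n^'n" coef_bound 0 by (rule matrix_ode[OF u])
  define P where "P = norm (mat 1 :: real^'n^'n) * exp (coef_bound * \<tau>)"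
  have bound: "norm (Phi u s r) \<le> P" if "0 \<le> s" "s \<le> r" "r \<le> \<tau>" for s r
  proof -
    have "norm (Phi u s r) \<le> norm (mat 1 :: real^'n^'n) * exp (coef_bound * (r - s))"
      using norm_solution_le[OF Phi_solves[OF u] \<open>s \<le> r\<close>] u by simp
    also have "\<dots> \<le> P"
      unfolding P_def using that K_nonneg by (intro mult_left_mono) (auto intro: mult_left_mono)
    finally show ?thesis .
  qed
  show ?thesis
  proof (rule that[of P "coef_bound * P"])
    show "0 \<le> P" "0 \<le> coef_bound * P" using K_nonneg by (simp_all add: P_def)
    fix s r assume sr: "0 \<le> s" "s \<le> r" "r \<le> \<tau>"
    then show "norm (Phi u s r) \<le> P" by (rule bound)
    show "norm (Phi u s r - mat 1) \<le> coef_bound * P * (r - s)"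
      using solution_lipschitz[OF Phi_solves[OF u] order_refl \<open>s \<le> r\<close>, of P] bound sr u by simp
  qed
qed

lemma particular_bounds:
  assumes u: "admissible u"
  obtains X L where "0 \<le> X" "0 \<le> L"
    "\<And>t. 0 \<le> t \<Longrightarrow> t \<le> \<tau> \<Longrightarrow> norm (particular u t) \<le> X"
    "\<And>t t'. 0 \<le> t \<Longrightarrow> t \<le> t' \<Longrightarrow> t' \<le> \<tau> \<Longrightarrow> norm (particular u t' - particular u t) \<le> L * (t' - t)"
proof -
  interpret linear_ode "(*v)" "coef u" "forcing u" coef_bound forcing_bound by (rule vector_ode[OF u])
  define X where "X = forcing_bound * \<bar>\<tau>\<bar> * exp (coef_bound * \<bar>\<tau>\<bar>)"
  have bound: "norm (particular u t) \<le> X" if "0 \<le> t" "t \<le> \<tau>" for t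
  proof -
    have "norm (particular u t) \<le> forcing_bound * t * exp (coef_bound * t)"
      using norm_solution_le[OF particular_solves[OF u] \<open>0 \<le> t\<close>] u by simp
    also have "\<dots> \<le> X"
      unfolding X_def using that K_nonneg G_nonneg
      by (intro mult_mono mult_left_mono) (auto intro: mult_left_mono)
    finally show ?thesis .
  qed
  show ?thesis
  proof (rule that[of X "coef_bound * X + forcing_bound"])
    show "0 \<le> X" "0 \<le> coef_bound * X + forcing_bound" using K_nonneg G_nonneg by (simp_all add: X_def)
    show "norm (particular u t) \<le> X" if "0 \<le> t" "t \<le> \<tau>" for t using bound that .
    fix t t' assume "0 \<le> t" "t \<le> t'" "t' \<le> \<tau>"
    then show "norm (particular u t' - particular u t) \<le> (coef_bound * X + forcing_bound) * (t' - t)"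
      using solution_lipschitz[OF particular_solves[OF u], of t t' X] bound by simp
  qed
qed

lemma continuous_on_Phi_initial:
  assumes u: "admissible u"
  shows "continuous_on {0..T} (\<lambda>s. Phi u s T)"
proof -
  obtain P L where PL: "0 \<le> P" "0 \<le> L"
    and P: "\<And>s r. 0 \<le> s \<Longrightarrow> s \<le> r \<Longrightarrow> r \<le> T \<Longrightarrow> norm (Phi u s r) \<le> P"
    and L: "\<And>s r. 0 \<le> s \<Longrightarrow> s \<le> r \<Longrightarrow> r \<le> T \<Longrightarrow> norm (Phi u s r - mat 1) \<le> L * (r - s)"
    using Phi_bounds[OF u, where \<tau>=T] by metis
  have lip: "norm (Phi u s T - Phi u s' T) \<le> P * L * (s' - s)" if "0 \<le> s" "s \<le> s'" "s' \<le> T" for s s'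
  proof -
    have "Phi u s T - Phi u s' T = Phi u s' T ** (Phi u s s' - mat 1)"
      using Phi_compose[OF u \<open>s \<le> s'\<close> \<open>s' \<le> T\<close>]
      by (simp add: bounded_bilinear.diff_right[OF bounded_bilinear_matrix_mult])
    also have "norm \<dots> \<le> norm (Phi u s' T) * norm (Phi u s s' - mat 1)"
      by (rule norm_matrix_mult_le)
    also have "\<dots> \<le> P * (L * (s' - s))"
      using P[of s' T] L[of s s'] PL that by (intro mult_mono) auto
    finally show ?thesis by simp
  qed
  show ?thesis
  proof (rule lipschitz_on_continuous_on[OF lipschitz_onI])
    fix x y assume "x \<in> {0..T}" "y \<in> {0..T}"
    then show "dist (Phi u x T) (Phi u y T) \<le> P * L * dist x y"
      using lip[of x y] lip[of y x]
      by (cases "x \<le> y") (auto simp: dist_norm norm_minus_commute)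
  next
    show "0 \<le> P * L" using PL by simp
  qed
qed

lemma Phi_forcing_integrable:
  assumes u: "admissible u" and "0 \<le> a" "b \<le> T"
  shows "(\<lambda>s. Phi u s T *v forcing u s) integrable_on {a..b}"
  using integrable_bilinear_measurable_continuous[OF
      bounded_bilinear.flip[OF bounded_bilinear_matrix_vector_mult] forcing_measurable[OF u] norm_forcing[OF u]
      continuous_on_subset[OF continuous_on_Phi_initial[OF u, of T]]] assms
  by fastforce

text \<open>Duhamel's formula \<open>x(t') = \<Phi>(t', t) x(t) + \<integral>\<^sub>t\<^sup>t\<^sup>' \<Phi>(t', s) f(s) ds\<close> says that this vanishes.\<close>
definition duhamel_defect :: "(real \<Rightarrow> real^'m) \<Rightarrow> real \<Rightarrow> real \<Rightarrow> real^'n" where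
  "duhamel_defect u t t' =
     particular u t' - Phi u t t' *v particular u t - integral {t..t'} (\<lambda>s. Phi u s t' *v forcing u s)"

lemma duhamel_defect_has_integral:
  assumes u: "admissible u" and t: "0 \<le> t" "t \<le> t'"
  shows "((\<lambda>r. coef u r *v (particular u r - Phi u t r *v particular u t) + (mat 1 - Phi u r t') *v forcing u r)
           has_integral duhamel_defect u t t') {t..t'}"
proof -
  have "((\<lambda>r. coef u r *v particular u r + forcing u r) has_integral (particular u t' - particular u t)) {t..t'}"
    using particular_solves[OF u] t unfolding solves_from_def by auto
  moreover have "((\<lambda>r. coef u r *v (Phi u t r *v particular u t) + 0)
                   has_integral (Phi u t t' *v particular u t - Phi u t t *v particular u t)) {t..t'}"
    using solves_from_mult_vector[OF Phi_solves[OF u]] t unfolding solves_from_def by blast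
  moreover have "((\<lambda>s. Phi u s t' *v forcing u s) has_integral integral {t..t'} (\<lambda>s. Phi u s t' *v forcing u s)) {t..t'}"
    using Phi_forcing_integrable[OF u t(1) order_refl] by (simp add: integrable_integral)
  ultimately have "((\<lambda>r. (coef u r *v particular u r + forcing u r) - (coef u r *v (Phi u t r *v particular u t) + 0)
                         - Phi u r t' *v forcing u r)
           has_integral (particular u t' - particular u t - (Phi u t t' *v particular u t - Phi u t t *v particular u t)
                         - integral {t..t'} (\<lambda>s. Phi u s t' *v forcing u s))) {t..t'}"
    by (intro has_integral_diff)
  then show ?thesis
    using u by (simp add: duhamel_defect_def matrix_vector_mult_diff_distrib matrix_vector_mult_diff_rdistrib
        algebra_simps)
qed

lemma norm_duhamel_integrand_le:
  assumes u: "admissible u"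
    and L: "norm (Phi u t r - mat 1) \<le> L * \<delta>" "norm (Phi u r t' - mat 1) \<le> L * \<delta>"
    and X: "norm (particular u t) \<le> X" and LX: "norm (particular u r - particular u t) \<le> LX * \<delta>"
  shows "norm (coef u r *v (particular u r - Phi u t r *v particular u t) + (mat 1 - Phi u r t') *v forcing u r)
    \<le> (coef_bound * LX + coef_bound * L * X + L * forcing_bound) * \<delta>"
proof -
  have "coef u r *v (particular u r - Phi u t r *v particular u t) + (mat 1 - Phi u r t') *v forcing u r
      = coef u r *v (particular u r - particular u t) - coef u r *v ((Phi u t r - mat 1) *v particular u t)
        - (Phi u r t' - mat 1) *v forcing u r"
    by (simp add: matrix_vector_mult_diff_distrib matrix_vector_mult_diff_rdistrib)
  also have "norm \<dots> \<le> norm (coef u r) * norm (particular u r - particular u t)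
      + norm (coef u r) * (norm (Phi u t r - mat 1) * norm (particular u t))
      + norm (Phi u r t' - mat 1) * norm (forcing u r)"
    by (intro order_trans[OF norm_triangle_ineq4] add_mono order_trans[OF norm_triangle_ineq4]
        order_trans[OF norm_matrix_vector_mult_le] mult_left_mono norm_matrix_vector_mult_le norm_ge_zero
        order_refl)
  also have "\<dots> \<le> coef_bound * (LX * \<delta>) + coef_bound * (L * \<delta> * X) + L * \<delta> * forcing_bound"
    using norm_coef[OF u] norm_forcing[OF u] coef_bound_nonneg[OF u] L X LX
    by (intro add_mono mult_mono) (auto intro: order_trans[OF norm_ge_zero])
  finally show ?thesis by (simp add: algebra_simps)
qed

lemma duhamel_defect_quadratic:
  assumes u: "admissible u"
  shows "\<exists>K. \<forall>t t'. 0 \<le> t \<longrightarrow> t \<le> t' \<longrightarrow> t' \<le> \<tau> \<longrightarrow> norm (duhamel_defect u t t') \<le> K * (t' - t)\<^sup>2"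
proof -
  obtain P L where PL: "0 \<le> P" "0 \<le> L"
    and "\<And>s r. 0 \<le> s \<Longrightarrow> s \<le> r \<Longrightarrow> r \<le> \<tau> \<Longrightarrow> norm (Phi u s r) \<le> P"
    and L: "\<And>s r. 0 \<le> s \<Longrightarrow> s \<le> r \<Longrightarrow> r \<le> \<tau> \<Longrightarrow> norm (Phi u s r - mat 1) \<le> L * (r - s)"
    using Phi_bounds[OF u, where \<tau>=\<tau>] by metis
  obtain X LX where X0: "0 \<le> X" "0 \<le> LX"
    and X: "\<And>t. 0 \<le> t \<Longrightarrow> t \<le> \<tau> \<Longrightarrow> norm (particular u t) \<le> X"
    and LX: "\<And>t t'. 0 \<le> t \<Longrightarrow> t \<le> t' \<Longrightarrow> t' \<le> \<tau> \<Longrightarrow> norm (particular u t' - particular u t) \<le> LX * (t' - t)"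
    using particular_bounds[OF u, where \<tau>=\<tau>] by metis
  define K where "K = coef_bound * LX + coef_bound * L * X + L * forcing_bound"
  show ?thesis
  proof (intro exI[of _ K] allI impI)
    fix t t' assume t: "0 \<le> t" "t \<le> t'" "t' \<le> \<tau>"
    have bound: "norm (coef u r *v (particular u r - Phi u t r *v particular u t)
                      + (mat 1 - Phi u r t') *v forcing u r) \<le> K * (t' - t)"
      if "r \<in> {t..t'} - {}" for r
      unfolding K_def
    proof (rule norm_duhamel_integrand_le[OF u])
      have r: "t \<le> r" "r \<le> t'" using that by auto
      show "norm (Phi u t r - mat 1) \<le> L * (t' - t)"
        using L[of t r] r t PL mult_left_mono[of "r - t" "t' - t" L] by simp
      show "norm (Phi u r t' - mat 1) \<le> L * (t' - t)"
        using L[of r t'] r t PL mult_left_mono[of "t' - r" "t' - t" L] by simp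
      show "norm (particular u r - particular u t) \<le> LX * (t' - t)"
        using LX[of t r] r t X0 mult_left_mono[of "r - t" "t' - t" LX] by simp
      show "norm (particular u t) \<le> X" using X t by simp
    qed
    have "0 \<le> K * (t' - t)"
      using PL X0 coef_bound_nonneg[OF u] forcing_bound_nonneg[OF u] t by (simp add: K_def)
    from has_integral_bound_real[OF this finite.emptyI duhamel_defect_has_integral[OF u t(1,2)] bound] t
    show "norm (duhamel_defect u t t') \<le> K * (t' - t)\<^sup>2" by (simp add: power2_eq_square)
  qed
qed

lemma variation_of_constants:
  assumes u: "admissible u" and \<tau>: "0 \<le> \<tau>"
  shows "integral {0..\<tau>} (\<lambda>s. Phi u s \<tau> *v forcing u s) = particular u \<tau>"
proof -
  let ?F = "\<lambda>T s. Phi u s T *v forcing u s"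
  define h where "h t = Phi u t \<tau> *v particular u t + integral {t..\<tau>} (?F \<tau>)" for t
  obtain P L where "0 \<le> P" "0 \<le> L"
    and P: "\<And>s r. 0 \<le> s \<Longrightarrow> s \<le> r \<Longrightarrow> r \<le> \<tau> \<Longrightarrow> norm (Phi u s r) \<le> P"
    and "\<And>s r. 0 \<le> s \<Longrightarrow> s \<le> r \<Longrightarrow> r \<le> \<tau> \<Longrightarrow> norm (Phi u s r - mat 1) \<le> L * (r - s)"
    using Phi_bounds[OF u, where \<tau>=\<tau>] by metis
  obtain K where K: "\<forall>t t'. 0 \<le> t \<longrightarrow> t \<le> t' \<longrightarrow> t' \<le> \<tau> \<longrightarrow> norm (duhamel_defect u t t') \<le> K * (t' - t)\<^sup>2"
    using duhamel_defect_quadratic[OF u, of \<tau>] by (elim exE)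
  \<comment> \<open>\<open>h\<close> is constant: its increments are the Duhamel defects, propagated to time \<open>\<tau>\<close>\<close>
  have "h \<tau> = h 0"
  proof (rule eq_if_quadratic_increments[OF \<tau>])
    fix t t' assume t: "0 \<le> t" "t \<le> t'" "t' \<le> \<tau>"
    have "integral {t..\<tau>} (?F \<tau>) = integral {t..t'} (?F \<tau>) + integral {t'..\<tau>} (?F \<tau>)"
      using t by (intro Henstock_Kurzweil_Integration.integral_combine[symmetric]
          Phi_forcing_integrable[OF u]) auto
    moreover have "integral {t..t'} (?F \<tau>) = Phi u t' \<tau> *v integral {t..t'} (?F t')"
    proof -
      have "integral {t..t'} (?F \<tau>) = integral {t..t'} (\<lambda>s. Phi u t' \<tau> *v ?F t' s)"
      proof (rule integral_cong)
        fix s assume "s \<in> {t..t'}"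
        then have "Phi u s \<tau> = Phi u t' \<tau> ** Phi u s t'" using t by (intro Phi_compose[OF u]) auto
        then show "?F \<tau> s = Phi u t' \<tau> *v ?F t' s" by (simp add: matrix_vector_mul_assoc)
      qed
      also have "\<dots> = Phi u t' \<tau> *v integral {t..t'} (?F t')"
        using Phi_forcing_integrable[OF u t(1) order_refl]
        by (simp add: integral_linear[where h="(*v) (Phi u t' \<tau>)", unfolded o_def])
      finally show ?thesis .
    qed
    moreover have "Phi u t \<tau> = Phi u t' \<tau> ** Phi u t t'" using t by (intro Phi_compose[OF u])
    ultimately have "h t' - h t = Phi u t' \<tau> *v duhamel_defect u t t'"
      unfolding h_def duhamel_defect_def
      by (simp add: matrix_vector_mul_assoc[symmetric] matrix_vector_mult_diff_distrib algebra_simps)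
    also have "norm \<dots> \<le> P * (K * (t' - t)\<^sup>2)"
      by (rule order_trans[OF norm_matrix_vector_mult_le])
        (use P[of t' \<tau>] K[rule_format, OF t] t \<open>0 \<le> P\<close> in \<open>intro mult_mono; simp\<close>)
    finally show "norm (h t' - h t) \<le> P * K * (t' - t)\<^sup>2" by simp
  qed
  then show ?thesis using u by (simp add: h_def)
qed

lemma integral_fundsol_forcing:
  assumes u: "admissible u" and \<tau>: "0 \<le> \<tau>"
  shows "integral {0..\<tau>} (\<lambda>s. fundsol A B u \<tau> s *v (C *v u s + d)) = particular u \<tau>"
proof -
  have "integral {0..\<tau>} (\<lambda>s. fundsol A B u \<tau> s *v (C *v u s + d))
      = integral {0..\<tau>} (\<lambda>s. Phi u s \<tau> *v forcing u s)"
    by (rule integral_cong) (simp add: fundsol_eq_Phi[OF u] forcing_def)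
  then show ?thesis using variation_of_constants[OF u \<tau>] by simp
qed

subsection \<open>Dependence on the control\<close>

lemma Phi_particular_tendsto:
  assumes adm: "\<And>k. admissible (u k)"
    and u_L1: "(\<lambda>k. integral {0..T} (\<lambda>r. norm (u k r - u 0 r))) \<longlonglongrightarrow> 0"
    and \<tau>: "\<tau> \<longlonglongrightarrow> \<tau> 0" "\<And>k. 0 \<le> \<tau> k" "\<tau> 0 < T"
  shows "(\<lambda>k. Phi (u k) 0 (\<tau> k)) \<longlonglongrightarrow> Phi (u 0) 0 (\<tau> 0)"
    and "(\<lambda>k. particular (u k) (\<tau> k)) \<longlonglongrightarrow> particular (u 0) (\<tau> 0)"
proof -
  have u_int: "(\<lambda>r. norm (u k r - u 0 r)) integrable_on {0..T}" for k
    using adm[of k] adm[of 0] unfolding admissible_def by (intro integrable_norm_diff_bounded) auto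
  have coef_lim: "(\<lambda>k. integral {0..T} (\<lambda>r. norm (coef (u k) r - coef (u 0) r))) \<longlonglongrightarrow> 0"
  proof (rule integral_tendsto_0_if_dominated[OF _ u_int _ _ u_L1])
    show "(\<lambda>r. norm (coef (u k) r - coef (u 0) r)) integrable_on {0..T}" for k
      by (rule integrable_norm_diff_bounded[OF coef_measurable[OF adm] coef_measurable[OF adm]
            norm_coef[OF adm] norm_coef[OF adm]])
    show "norm (coef (u k) r - coef (u 0) r) \<le> (\<Sum>i\<in>UNIV. norm (B i)) * norm (u k r - u 0 r)" for k r
      unfolding coef_def using norm_Amat_diff_le[of A B "u k r" "u 0 r"] by (simp add: mult.commute)
  qed simp
  have forcing_lim: "(\<lambda>k. integral {0..T} (\<lambda>r. norm (forcing (u k) r - forcing (u 0) r))) \<longlonglongrightarrow> 0"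
  proof (rule integral_tendsto_0_if_dominated[OF _ u_int _ _ u_L1])
    show "(\<lambda>r. norm (forcing (u k) r - forcing (u 0) r)) integrable_on {0..T}" for k
      by (rule integrable_norm_diff_bounded[OF forcing_measurable[OF adm] forcing_measurable[OF adm]
            norm_forcing[OF adm] norm_forcing[OF adm]])
    show "norm (forcing (u k) r - forcing (u 0) r) \<le> norm C * norm (u k r - u 0 r)" for k r
      unfolding forcing_def using norm_matrix_vector_mult_le[of C "u k r - u 0 r"]
      by (simp add: matrix_vector_mult_diff_distrib)
  qed simp
  show "(\<lambda>k. Phi (u k) 0 (\<tau> k)) \<longlonglongrightarrow> Phi (u 0) 0 (\<tau> 0)"
    using adm by (intro solution_tendsto[OF matrix_ode matrix_ode Phi_solves Phi_solves _ coef_lim _ \<tau>(1)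
          \<tau>(2)[of 0] \<tau>(3,2)]) auto
  show "(\<lambda>k. particular (u k) (\<tau> k)) \<longlonglongrightarrow> particular (u 0) (\<tau> 0)"
    using adm by (intro solution_tendsto[OF vector_ode vector_ode particular_solves particular_solves _ coef_lim
          forcing_lim \<tau>(1) \<tau>(2)[of 0] \<tau>(3,2)]) auto
qed

lemma periodic_initial_values_diverge:
  assumes adm: "\<And>k. admissible (u k)" and \<tau>: "\<And>k. 0 < \<tau> k" "\<tau> \<longlonglongrightarrow> \<tau> 0" "\<tau> 0 < T"
    and u_L1: "(\<lambda>k. integral {0..T} (\<lambda>r. norm (u k r - u 0 r))) \<longlonglongrightarrow> 0"
    and unsolvable: "particular (u 0) (\<tau> 0) \<notin> range (\<lambda>y. (mat 1 - Phi (u 0) 0 (\<tau> 0)) *v y)"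
    and xs: "\<forall>k\<ge>1. is_periodic_solution A B C d (u k) (\<tau> k) (xs k)"
  shows "filterlim (\<lambda>k. norm (xs k 0)) at_top sequentially"
    and "(\<lambda>k. infdist (xs k 0 /\<^sub>R norm (xs k 0)) {v. (mat 1 - Phi (u 0) 0 (\<tau> 0)) *v v = 0}) \<longlonglongrightarrow> 0"
proof -
  have "0 \<le> \<tau> k" for k using \<tau>(1)[of k] by simp
  note lims = Phi_particular_tendsto[OF adm u_L1 \<tau>(2) this \<tau>(3)]
  have Phi_lim: "(\<lambda>k. mat 1 - Phi (u k) 0 (\<tau> k)) \<longlonglongrightarrow> mat 1 - Phi (u 0) 0 (\<tau> 0)"
    by (intro tendsto_diff tendsto_const lims)
  have eq: "\<forall>\<^sub>F k in sequentially. (mat 1 - Phi (u k) 0 (\<tau> k)) *v xs k 0 = particular (u k) (\<tau> k)"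
    using eventually_ge_at_top[of 1]
    by eventually_elim (use xs periodic_solution_initial[OF adm _ \<tau>(1)] in blast)
  show "filterlim (\<lambda>k. norm (xs k 0)) at_top sequentially"
    by (rule norm_solution_tendsto_infinity[OF Phi_lim lims(2) eq unsolvable])
  then show "(\<lambda>k. infdist (xs k 0 /\<^sub>R norm (xs k 0)) {v. (mat 1 - Phi (u 0) 0 (\<tau> 0)) *v v = 0}) \<longlonglongrightarrow> 0"
    by (rule direction_tendsto_kernel[OF Phi_lim lims(2) eq])
qed

end

theorem lemma3p8:
  fixes A :: "real^'n^'n" and B :: "'m::finite \<Rightarrow> real^'n^'n"
    and C :: "real^'m^'n" and d :: "real^'n" and \<Omega> :: "(real^'m) set"
    and u :: "nat \<Rightarrow> real \<Rightarrow> real^'m" and \<tau> :: "nat \<Rightarrow> real" and c :: real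
  assumes \<Omega>_bdd: "bounded \<Omega>"
    and u_meas: "\<And>k. u k \<in> borel_measurable borel"
    and u_val: "\<And>k t. u k t \<in> \<Omega>"
    and \<tau>_pos: "\<And>k. \<tau> k > 0"
    and u_per: "\<And>k t. u k (t + \<tau> k) = u k t"
    and \<tau>_lim: "\<tau> \<longlonglongrightarrow> \<tau> 0"
    and u_L1: "(\<lambda>k. integral {0..\<tau> 0 + 1} (\<lambda>t. norm (u k t - u 0 t))) \<longlonglongrightarrow> 0"
    and c_pos: "c > 0"
    and u_bdd: "\<And>k t. norm (u k t) \<le> c"
    and spec0: "one_in_spec (fundsol A B (u 0) (\<tau> 0) 0)"
    and speck: "\<And>k. k \<ge> 1 \<Longrightarrow> \<not> one_in_spec (fundsol A B (u k) (\<tau> k) 0)"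
    and nonres: "integral {0..\<tau> 0} (\<lambda>s. fundsol A B (u 0) (\<tau> 0) s *v (C *v u 0 s + d))
                   \<notin> range (\<lambda>y. (mat 1 - fundsol A B (u 0) (\<tau> 0) 0) *v y)"
  shows "(\<forall>k\<ge>1. \<exists>!x. is_periodic_solution A B C d (u k) (\<tau> k) x)
       \<and> (\<forall>xs :: nat \<Rightarrow> real \<Rightarrow> real^'n.
            (\<forall>k\<ge>1. is_periodic_solution A B C d (u k) (\<tau> k) (xs k)) \<longrightarrow>
              filterlim (\<lambda>k. norm (xs k 0)) at_top sequentially
            \<and> (\<lambda>k. infdist (xs k 0 /\<^sub>R norm (xs k 0))
                     {v. (mat 1 - fundsol A B (u 0) (\<tau> 0) 0) *v v = 0}) \<longlonglongrightarrow> 0)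
       \<and> {v. (mat 1 - fundsol A B (u 0) (\<tau> 0) 0) *v v = 0}
           = eigenspace_real (fundsol A B (u 0) (\<tau> 0) 0) 1"
proof -
  \<comment> \<open>\<open>\<Omega>_bdd\<close>, \<open>u_val\<close> and \<open>c_pos\<close> are subsumed by \<open>u_bdd\<close>, and \<open>spec0\<close> follows from \<open>nonres\<close>.\<close>
  interpret control_system A B C d c .
  have adm: "admissible (u k)" for k unfolding admissible_def using u_meas u_bdd by auto
  have Phi_eq: "fundsol A B (u k) (\<tau> k) 0 = Phi (u k) 0 (\<tau> k)" for k
    using fundsol_eq_Phi[OF adm] \<tau>_pos[of k] by simp
  have unsolvable: "particular (u 0) (\<tau> 0) \<notin> range (\<lambda>y. (mat 1 - Phi (u 0) 0 (\<tau> 0)) *v y)"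
    using nonres integral_fundsol_forcing[OF adm, of "\<tau> 0"] \<tau>_pos[of 0] by (simp add: Phi_eq)
  note diverge = periodic_initial_values_diverge[OF adm \<tau>_pos \<tau>_lim less_add_one u_L1 unsolvable]
  have "\<forall>k\<ge>1. \<exists>!x. is_periodic_solution A B C d (u k) (\<tau> k) x"
    using periodic_solution_ex1[OF adm \<tau>_pos u_per] speck by (simp add: Phi_eq)
  with diverge show ?thesis
    unfolding Phi_eq eigenspace_real_def by (auto simp: matrix_vector_mult_diff_rdistrib)
qed

end
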